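(* There exists a deterministic algorithm which, given a transformed special instance $(F,\alpha)$ of $(\nu(F)+k)$-SAT, decides whether $\mathrm{sat}(F)\ge\alpha$ in time $O\big((2e)^{2k+O(\log^2 k)}(m+n)^{O(1)}\big)$, where $k=\alpha-\nu(F)$, $n=|V(F)|$, $m=|F|$.
   Context: A CNF formula $F$ is a finite multiset of clauses; each clause is a nonempty set of literals (a variable $x$ or its negation $\bar x$) not containing both a variable and its negation. $V(F)$ is the set of variables, $V(c)$ the set of variables of clause $c$. A truth assignment satisfies a clause if some literal of it is true; $\mathrm{sat}(F)$ is the maximum number of clauses (with multiplicity) satisfied by a truth assignment. $B_F$ is the bipartite graph on $V(F)\cup F$ with $v$ adjacent to $c$ iff $v\in V(c)$, and $\nu(F)$ is the maximum matching size of $B_F$. $(\nu(F)+k)$-SAT: given $F$ and a positive integer $\alpha$, parameter $k=\alpha-\nu(F)$, decide whether $\mathrm{sat}(F)\ge\alpha$. For a variable $x$, $n(x)$ and $n(\bar x)$ denote the numbers of clauses containing the literal $x$ and $\bar x$ respectively. An instance $(F,\alpha)$ is a transformed special instance if: every clause contains at most one positive literal; for every variable $x$, $n(x)=1$ and $n(\bar x)\ge 2$; and for every variable $x$ the unique clause containing the literal $x$ is the unit clause $(x)$. *)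

theory Defs
  imports Complex_Main "HOL-Library.Multiset" "HOL-Library.Landau_Symbols" "HOL-Library.Log_Nat"
begin

section \<open>CNF formulas\<close>

datatype 'v literal = Pos 'v | Neg 'v

fun var :: "'v literal \<Rightarrow> 'v" where
  "var (Pos x) = x"
| "var (Neg x) = x"

type_synonym 'v clause = "'v literal set"
type_synonym 'v cnf = "'v clause multiset"

definition clause_vars :: "'v clause \<Rightarrow> 'v set" where
  "clause_vars c = var ` c"

definition vars :: "'v cnf \<Rightarrow> 'v set" where
  "vars F = (\<Union>c\<in>set_mset F. clause_vars c)"

definition is_clause :: "'v clause \<Rightarrow> bool" where
  "is_clause c \<longleftrightarrow> finite c \<and> c \<noteq> {} \<and> (\<forall>x. \<not> (Pos x \<in> c \<and> Neg x \<in> c))"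

definition is_cnf :: "'v cnf \<Rightarrow> bool" where
  "is_cnf F \<longleftrightarrow> (\<forall>c\<in>#F. is_clause c)"

fun lit_true :: "('v \<Rightarrow> bool) \<Rightarrow> 'v literal \<Rightarrow> bool" where
  "lit_true \<tau> (Pos x) = \<tau> x"
| "lit_true \<tau> (Neg x) = (\<not> \<tau> x)"

definition satisfies :: "('v \<Rightarrow> bool) \<Rightarrow> 'v clause \<Rightarrow> bool" where
  "satisfies \<tau> c \<longleftrightarrow> (\<exists>l\<in>c. lit_true \<tau> l)"

definition sat :: "'v cnf \<Rightarrow> nat" where
  "sat F = Max (range (\<lambda>\<tau>. size (filter_mset (satisfies \<tau>) F)))"

lemma finite_sat_values: "finite (range (\<lambda>\<tau>. size (filter_mset (satisfies \<tau>) F)))"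
  by (rule finite_subset[of _ "{..size F}"]) (auto simp: size_filter_mset_lesseq)

definition occ :: "'v cnf \<Rightarrow> 'v literal \<Rightarrow> nat" where
  "occ F l = size {#c \<in># F. l \<in> c#}"


section \<open>The bipartite graph \<open>B_F\<close> and its matching number\<close>

text \<open>As \<open>F\<close> is a multiset, its vertices in \<open>B_F\<close> are the clause occurrences
  \<open>(c, i)\<close> with \<open>i < count F c\<close>. Edges are two-element vertex sets.\<close>

definition incidence_edges :: "'v cnf \<Rightarrow> ('v + 'v clause \<times> nat) set set" where
  "incidence_edges F = {{Inl v, Inr (c, i)} | v c i. i < count F c \<and> v \<in> clause_vars c}"

definition matching :: "'a set set \<Rightarrow> 'a set set \<Rightarrow> bool" where
  "matching E M \<longleftrightarrow> M \<subseteq> E \<and> pairwise disjnt M"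

definition matching_number :: "'v cnf \<Rightarrow> nat" where
  "matching_number F = Max {card M | M. matching (incidence_edges F) M}"

lemma finite_incidence_edges:
  assumes "is_cnf F"
  shows "finite (incidence_edges F)"
proof -
  let ?S = "SIGMA c:set_mset F. {..<count F c} \<times> clause_vars c"
  have "finite ?S"
    using assms by (auto simp: is_cnf_def is_clause_def clause_vars_def)
  moreover have "incidence_edges F \<subseteq> (\<lambda>(c, i, v). {Inl v, Inr (c, i)}) ` ?S"
  proof
    fix e assume "e \<in> incidence_edges F"
    then obtain v c i where *: "e = {Inl v, Inr (c, i)}" "i < count F c" "v \<in> clause_vars c"
      by (auto simp: incidence_edges_def)
    moreover have "c \<in># F"
      using *(2) by (metis count_inI less_zeroE)
    ultimately show "e \<in> (\<lambda>(c, i, v). {Inl v, Inr (c, i)}) ` ?S"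
      by (intro image_eqI[of _ _ "(c, i, v)"]) auto
  qed
  ultimately show ?thesis
    by (meson finite_imageI finite_subset)
qed

lemma finite_matching_sizes:
  assumes "is_cnf F"
  shows "finite {card M | M. matching (incidence_edges F) M}"
proof -
  have "{card M | M. matching (incidence_edges F) M} \<subseteq> card ` Pow (incidence_edges F)"
    by (auto simp: matching_def)
  then show ?thesis
    using finite_incidence_edges[OF assms] by (meson finite_Pow_iff finite_imageI finite_subset)
qed


section \<open>Transformed special instances\<close>

definition transformed_special_instance :: "'v cnf \<Rightarrow> nat \<Rightarrow> bool" where
  "transformed_special_instance F \<alpha> \<longleftrightarrow>
     is_cnf F \<and> \<alpha> > 0 \<and>
     (\<forall>c\<in>#F. card {x. Pos x \<in> c} \<le> 1) \<and>
     (\<forall>x\<in>vars F. occ F (Pos x) = 1 \<and> occ F (Neg x) \<ge> 2) \<and>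
     (\<forall>x\<in>vars F. \<forall>c\<in>#F. Pos x \<in> c \<longrightarrow> c = {Pos x})"

text \<open>The parameter is an integer: it is negative if \<open>\<alpha> < \<nu>(F)\<close>.\<close>

definition parameter :: "'v cnf \<Rightarrow> nat \<Rightarrow> int" where
  "parameter F \<alpha> = int \<alpha> - int (matching_number F)"


section \<open>Algorithms: random access machine programs with logarithmic cost\<close>

text \<open>The model is the random access machine of Aho, Hopcroft and Ullman under the logarithmic
  cost criterion, with structured control flow in place of jumps. A state consists of a memory,
  whose cells hold natural numbers, and the part of the read-only input not yet consumed.
  Nested uses of \<open>Cell\<close> give indirect addressing.\<close>

datatype aexp =
    Const nat
  | Cell aexp
  | Plus aexp aexp
  | Minus aexp aexp
  | Times aexp aexp
  | Div aexp aexp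

datatype com =
    Skip
  | Store aexp aexp
  | Read aexp
  | Seq com com
  | If aexp com com
  | While aexp com

type_synonym memory = "nat \<Rightarrow> nat"
type_synonym state = "memory \<times> nat list"

fun aval :: "aexp \<Rightarrow> memory \<Rightarrow> nat" where
  "aval (Const n) s = n"
| "aval (Cell a) s = s (aval a s)"
| "aval (Plus a b) s = aval a s + aval b s"
| "aval (Minus a b) s = aval a s - aval b s"
| "aval (Times a b) s = aval a s * aval b s"
| "aval (Div a b) s = aval a s div aval b s"

text \<open>The number of bits of the binary representation, where \<open>0\<close> takes one bit.\<close>

definition bitlen :: "nat \<Rightarrow> nat" where
  "bitlen n = max 1 (floorlog 2 n)"

fun acost :: "aexp \<Rightarrow> memory \<Rightarrow> nat" where
  "acost (Const n) s = bitlen n"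
| "acost (Cell a) s = acost a s + bitlen (aval a s) + bitlen (s (aval a s))"
| "acost (Plus a b) s = acost a s + acost b s + bitlen (aval a s) + bitlen (aval b s)"
| "acost (Minus a b) s = acost a s + acost b s + bitlen (aval a s) + bitlen (aval b s)"
| "acost (Times a b) s = acost a s + acost b s + bitlen (aval a s) + bitlen (aval b s)"
| "acost (Div a b) s = acost a s + acost b s + bitlen (aval a s) + bitlen (aval b s)"

text \<open>\<open>exec c s t s'\<close>: started in state \<open>s\<close>, program \<open>c\<close> terminates in state \<open>s'\<close> after time \<open>t\<close>.
  A nonzero guard counts as true; reading from an exhausted input yields \<open>0\<close>.\<close>

inductive exec :: "com \<Rightarrow> state \<Rightarrow> nat \<Rightarrow> state \<Rightarrow> bool" where
  Skip: "exec Skip s 1 s"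
| Store: "exec (Store a b) (s, w)
     (1 + acost a s + acost b s + bitlen (aval a s) + bitlen (aval b s))
     (s(aval a s := aval b s), w)"
| ReadNil: "exec (Read a) (s, [])
     (1 + acost a s + bitlen (aval a s) + bitlen 0) (s(aval a s := 0), [])"
| ReadCons: "exec (Read a) (s, x # w)
     (1 + acost a s + bitlen (aval a s) + bitlen x) (s(aval a s := x), w)"
| Seq: "exec c s t s' \<Longrightarrow> exec d s' u s'' \<Longrightarrow> exec (Seq c d) s (1 + t + u) s''"
| IfTrue: "aval b (fst s) \<noteq> 0 \<Longrightarrow> exec c s t s' \<Longrightarrow> exec (If b c d) s (1 + acost b (fst s) + t) s'"
| IfFalse: "aval b (fst s) = 0 \<Longrightarrow> exec d s t s' \<Longrightarrow> exec (If b c d) s (1 + acost b (fst s) + t) s'"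
| WhileFalse: "aval b (fst s) = 0 \<Longrightarrow> exec (While b c) s (1 + acost b (fst s)) s"
| WhileTrue: "aval b (fst s) \<noteq> 0 \<Longrightarrow> exec c s t s' \<Longrightarrow> exec (While b c) s' u s'' \<Longrightarrow>
     exec (While b c) s (1 + acost b (fst s) + t + u) s''"

lemma exec_deterministic:
  "exec c s t s' \<Longrightarrow> exec c s u s'' \<Longrightarrow> u = t \<and> s'' = s'"
proof (induction arbitrary: u s'' rule: exec.induct)
  case (Seq c s t s' d v s2)
  from Seq.prems show ?case
    by (cases rule: exec.cases) (blast dest: Seq.IH)
next
  case (IfTrue b s c t s' d)
  from IfTrue.prems IfTrue.hyps(1) show ?case
    by (cases rule: exec.cases) (auto dest: IfTrue.IH)
next
  case (IfFalse b s d t s' c)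
  from IfFalse.prems IfFalse.hyps(1) show ?case
    by (cases rule: exec.cases) (auto dest: IfFalse.IH)
next
  case (WhileFalse b s c)
  from WhileFalse.prems WhileFalse.hyps(1) show ?case
    by (cases rule: exec.cases) auto
next
  case (WhileTrue b s c t s' v s2)
  from WhileTrue.prems show ?case
  proof (cases rule: exec.cases)
    case WhileFalse
    with WhileTrue.hyps(1) show ?thesis by simp
  next
    case (WhileTrue t1 s1 u1)
    then show ?thesis
      using \<open>\<And>u s''. exec c s u s'' \<Longrightarrow> u = t \<and> s'' = s'\<close>
        \<open>\<And>u s''. exec (While b c) s' u s'' \<Longrightarrow> u = v \<and> s'' = s2\<close> by metis
  qed
qed (erule exec.cases; simp)+

definition initial_state :: "nat list \<Rightarrow> state" where
  "initial_state w = ((\<lambda>_. 0), w)"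

text \<open>\<open>outputs_within c w b T\<close>: on input \<open>w\<close>, program \<open>c\<close> halts in time at most \<open>T\<close>
  with the Boolean answer \<open>b\<close> in memory cell \<open>0\<close>.\<close>

definition outputs_within :: "com \<Rightarrow> nat list \<Rightarrow> bool \<Rightarrow> real \<Rightarrow> bool" where
  "outputs_within c w b T \<longleftrightarrow>
     (\<exists>t s'. exec c (initial_state w) t s' \<and> real t \<le> T \<and> fst s' 0 = (if b then 1 else 0))"


section \<open>Encoding of instances\<close>

text \<open>Clauses are presented as lists of literals, in any order, and the variables are numbered
  \<open>0, \<dots>, n - 1\<close> in any way, so the size of an encoding depends on the formula and not on the
  names of its variables.\<close>

fun lit_code :: "('v \<Rightarrow> nat) \<Rightarrow> 'v literal \<Rightarrow> nat" where
  "lit_code num (Pos x) = 2 * num x"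
| "lit_code num (Neg x) = 2 * num x + 1"

definition encode :: "('v \<Rightarrow> nat) \<Rightarrow> nat \<Rightarrow> 'v literal list list \<Rightarrow> nat \<Rightarrow> nat list" where
  "encode num n cs \<alpha> =
     [\<alpha>, n, length cs] @ concat (map (\<lambda>c. length c # map (lit_code num) c) cs)"

definition encodes :: "nat list \<Rightarrow> 'v cnf \<Rightarrow> nat \<Rightarrow> bool" where
  "encodes w F \<alpha> \<longleftrightarrow>
     (\<exists>num cs. bij_betw num (vars F) {..<card (vars F)} \<and>
        (\<forall>c\<in>set cs. distinct c) \<and> mset (map set cs) = F \<and>
        w = encode num (card (vars F)) cs \<alpha>)"

end

theory Submission
  imports Defs "HOL-Library.Nat_Bijection"
begin

text \<open>
  In a transformed special instance every non-unit clause is purely negative and each variable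
  \<open>x\<close> owns one unit clause \<open>(x)\<close>. Hence \<open>\<nu>(F) \<le> n\<close>, and setting exactly the variables in \<open>S\<close> to false
  satisfies \<open>n - |S| + |E(S)|\<close> clauses, where \<open>E(S)\<close> is the set of clauses hit by \<open>S\<close>. One has to decide
  whether \<open>|E(S)| - |S| \<ge> k\<close> for some \<open>S\<close>, where \<open>k = \<alpha> - n\<close>.

  No colour coding is needed for this. Greedily collect variables that hit at least two new clauses.
  If the resulting set \<open>U\<close> of clauses does not already witness a positive answer, then \<open>|U| < 2k\<close>,
  and every variable hits at most one clause outside \<open>U\<close>. Now a dynamic program over the subsets of
  \<open>U\<close>, which admits the outside clauses one by one, finds the maximum of \<open>|E(S)| - |S|\<close> in
  \<open>4\<^sup>k\<close> times polynomially many steps. Bit lengths grow by a bounded amount per step, so the logarithmic cost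
  is at most quadratic in the number of steps, and \<open>16 \<le> (2e)\<^sup>2\<close>.
\<close>

section \<open>Step counting for RAM programs\<close>

text \<open>The table can be indexed by subsets of \<open>U\<close> alone for the following reason.
  Let every variable have at most one clause outside \<open>U\<close>, and admit the outside clauses
  by increasing index. The clause \<open>j\<close> also repays the cost 1 of \<open>x\<close>, so
  the recurrence for these rounds has no \<open>- 1\<close>. The bound on \<open>|U|\<close> comes
  from two inequalities: each of the \<open>t\<close> greedy variables brings at least two clauses,
  so \<open>2 * t \<le> |U|\<close>, and if they are no witness, then \<open>|U| < k + t\<close>. On
  the machine the obstacle is multiplication, since iterated squaring would double bit lengths in
  every step. Products therefore occur only in addresses and guards, never as stored values.
  Truncated subtraction replaces comparison throughout.\<close>

definition fits :: "nat \<Rightarrow> memory \<Rightarrow> nat list \<Rightarrow> bool" where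
  "fits L s w \<longleftrightarrow> (\<forall>a. s a < 2 ^ L) \<and> (\<forall>x\<in>set w. x < 2 ^ L)"

text \<open>\<open>N\<close> bounds the number of steps. It also bounds the growth of the bit lengths, which makes the
  logarithmic cost at most \<open>N * (L + N)\<close> and lets the bound compose sequentially.\<close>

definition wp :: "com \<Rightarrow> nat \<Rightarrow> (memory \<Rightarrow> nat list \<Rightarrow> bool) \<Rightarrow> memory \<Rightarrow> nat list \<Rightarrow> bool" where
  "wp c N Q s w \<longleftrightarrow> (\<exists>t s' w'. exec c (s, w) t (s', w') \<and> Q s' w' \<and>
     (\<forall>L. fits L s w \<longrightarrow> fits (L + N) s' w' \<and> t \<le> N * (L + N)))"

text \<open>Up to the factor \<open>L + 1\<close>, one number bounds the bit length of the value and
  the cost of evaluation. Operands count twice because their evaluation and their length are both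
  charged. For \<open>Const n\<close> the reason is \<open>n < 2 ^ n\<close>.\<close>

fun weight :: "aexp \<Rightarrow> nat" where
  "weight (Const n) = n + 1"
| "weight (Cell a) = 2 * weight a + 1"
| "weight (Plus a b) = 2 * weight a + 2 * weight b + 1"
| "weight (Minus a b) = 2 * weight a + 2 * weight b + 1"
| "weight (Times a b) = 2 * weight a + 2 * weight b + 1"
| "weight (Div a b) = 2 * weight a + 2 * weight b + 1"

text \<open>\<open>Cell a\<close> qualifies for every \<open>a\<close>, since the content read is
  below \<open>2 ^ L\<close> whatever the address. This admits products inside addresses.\<close>

fun additive :: "aexp \<Rightarrow> bool" where
  "additive (Const n) = True"
| "additive (Cell a) = True"
| "additive (Plus a b) = (additive a \<and> additive b)"
| "additive (Minus a b) = (additive a \<and> additive b)"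
| "additive (Times a b) = False"
| "additive (Div a b) = (additive a \<and> additive b)"

section \<open>Bit lengths and evaluation cost of expressions\<close>

lemma fits_mono: "fits L s w \<Longrightarrow> L \<le> L' \<Longrightarrow> fits L' s w"
  unfolding fits_def by (meson less_le_trans one_le_numeral power_increasing)

lemma bitlen_le: "v < 2 ^ E \<Longrightarrow> 1 \<le> E \<Longrightarrow> bitlen v \<le> E"
  unfolding bitlen_def by (simp add: floorlog_leI)

lemma weight_pos: "1 \<le> weight a"
  by (cases a) auto

lemma aval_less:
  assumes "fits L s w"
  shows "aval a s < 2 ^ (weight a * (L + 1))"
proof (induction a)
  case (Const n)
  have "n < 2 ^ n" by (rule less_exp)
  also have "\<dots> \<le> 2 ^ ((n + 1) * (L + 1))" by (rule power_increasing) auto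
  finally show ?case by simp
next
  case (Cell a)
  have "s (aval a s) < 2 ^ L" using assms by (simp add: fits_def)
  also have "\<dots> \<le> 2 ^ (weight (Cell a) * (L + 1))" by (rule power_increasing) auto
  finally show ?case by simp
next
  case (Plus a b)
  let ?x = "weight a * (L + 1)" and ?y = "weight b * (L + 1)"
  have "aval a s + aval b s < 2 ^ (?x + ?y) + 2 ^ (?x + ?y)"
    using less_le_trans[OF Plus.IH(1) power_increasing[of ?x "?x + ?y" 2]]
      less_le_trans[OF Plus.IH(2) power_increasing[of ?y "?x + ?y" 2]] by simp
  also have "\<dots> = 2 ^ Suc (?x + ?y)" by simp
  also have "\<dots> \<le> 2 ^ (weight (Plus a b) * (L + 1))"
    by (rule power_increasing) (auto simp: algebra_simps)
  finally show ?case by simp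
next
  case (Minus a b)
  have "aval a s - aval b s < 2 ^ (weight a * (L + 1))" using Minus.IH(1) by simp
  also have "\<dots> \<le> 2 ^ (weight (Minus a b) * (L + 1))"
    by (rule power_increasing) (auto simp: algebra_simps)
  finally show ?case by simp
next
  case (Times a b)
  let ?x = "weight a * (L + 1)" and ?y = "weight b * (L + 1)"
  have "aval a s * aval b s < 2 ^ ?x * 2 ^ ?y"
    using Times.IH by (intro mult_strict_mono) auto
  also have "\<dots> = 2 ^ (?x + ?y)" by (simp add: power_add)
  also have "\<dots> \<le> 2 ^ (weight (Times a b) * (L + 1))"
    by (rule power_increasing) (auto simp: algebra_simps)
  finally show ?case by simp
next
  case (Div a b)
  have "aval a s div aval b s < 2 ^ (weight a * (L + 1))"
    using Div.IH(1) by (meson div_le_dividend le_less_trans)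
  also have "\<dots> \<le> 2 ^ (weight (Div a b) * (L + 1))"
    by (rule power_increasing) (auto simp: algebra_simps)
  finally show ?case by simp
qed

lemma bitlen_aval:
  assumes "fits L s w"
  shows "bitlen (aval a s) \<le> weight a * (L + 1)"
proof (rule bitlen_le[OF aval_less[OF assms]])
  show "1 \<le> weight a * (L + 1)" using weight_pos[of a] by auto
qed

lemma acost_le:
  assumes "fits L s w"
  shows "acost a s \<le> weight a * (L + 1)"
proof (induction a)
  case (Const n)
  show ?case using bitlen_aval[OF assms, of "Const n"] by simp
next
  case (Cell a)
  have "s (aval a s) < 2 ^ (L + 1)" using fits_mono[OF assms, of "L + 1"] by (simp add: fits_def)
  then have "bitlen (s (aval a s)) \<le> L + 1" by (rule bitlen_le) simp
  with Cell.IH bitlen_aval[OF assms, of a] show ?case by (simp add: algebra_simps)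
next
  case (Plus a b)
  with bitlen_aval[OF assms, of a] bitlen_aval[OF assms, of b] show ?case
    by (simp add: algebra_simps)
next
  case (Minus a b)
  with bitlen_aval[OF assms, of a] bitlen_aval[OF assms, of b] show ?case
    by (simp add: algebra_simps)
next
  case (Times a b)
  with bitlen_aval[OF assms, of a] bitlen_aval[OF assms, of b] show ?case
    by (simp add: algebra_simps)
next
  case (Div a b)
  with bitlen_aval[OF assms, of a] bitlen_aval[OF assms, of b] show ?case
    by (simp add: algebra_simps)
qed

text \<open>A stored value may lengthen by an additive constant only; a factor, as in
  \<open>aval_less\<close>, would compound over the run to exponential bit lengths.\<close>

lemma aval_additive_less:
  assumes "fits L s w"
  shows "additive a \<Longrightarrow> aval a s < 2 ^ (L + weight a)"
proof (induction a)
  case (Const n)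
  have "n < 2 ^ n" by (rule less_exp)
  also have "\<dots> \<le> 2 ^ (L + weight (Const n))" by (rule power_increasing) auto
  finally show ?case by simp
next
  case (Cell a)
  have "s (aval a s) < 2 ^ L" using assms by (simp add: fits_def)
  also have "\<dots> \<le> 2 ^ (L + weight (Cell a))" by (rule power_increasing) auto
  finally show ?case by simp
next
  case (Plus a b)
  let ?z = "L + weight a + weight b"
  have "aval a s + aval b s < 2 ^ ?z + 2 ^ ?z"
    using Plus less_le_trans[OF _ power_increasing[of "L + weight a" ?z 2], of "aval a s"]
      less_le_trans[OF _ power_increasing[of "L + weight b" ?z 2], of "aval b s"] 
    by (intro add_strict_mono) auto
  also have "\<dots> = 2 ^ Suc ?z" by simp
  also have "\<dots> \<le> 2 ^ (L + weight (Plus a b))" by (rule power_increasing) auto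
  finally show ?case by simp
next
  case (Minus a b)
  then have "aval a s - aval b s < 2 ^ (L + weight a)" by (simp add: less_imp_diff_less)
  also have "\<dots> \<le> 2 ^ (L + weight (Minus a b))" by (rule power_increasing) auto
  finally show ?case by simp
next
  case (Div a b)
  then have "aval a s div aval b s < 2 ^ (L + weight a)"
    using div_le_dividend le_less_trans by (metis additive.simps(6))
  also have "\<dots> \<le> 2 ^ (L + weight (Div a b))" by (rule power_increasing) auto
  finally show ?case by simp
qed simp

text \<open>Any constant exceeding the weights of all expressions of the program below would do.\<close>

definition unit_cost :: nat where "unit_cost = 100000"

abbreviation "K \<equiv> unit_cost"

lemma unit_cost_bound: "x \<le> K \<Longrightarrow> x * (L + 1) \<le> K * (L + K)"
  by (intro mult_mono) (auto simp: unit_cost_def)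

section \<open>Rules for commands\<close>

lemma wp_mono:
  assumes "wp c N Q s w" "N \<le> N'" "\<And>s w. Q s w \<Longrightarrow> Q' s w"
  shows "wp c N' Q' s w"
proof -
  have "N * (L + N) \<le> N' * (L + N')" for L
    using assms(2) by (intro mult_mono) auto
  then show ?thesis
    using assms unfolding wp_def by (meson add_left_mono fits_mono le_trans)
qed

lemma wp_Skip: "Q s w \<Longrightarrow> wp Skip K Q s w"
  unfolding wp_def
  using unit_cost_bound[of 1]
  by (intro exI conjI) (rule exec.Skip, auto intro: fits_mono simp: unit_cost_def)

text \<open>Only \<open>b\<close> has to be additive: the address \<open>a\<close> is charged but
  not kept in memory.\<close>

lemma wp_Store:
  assumes "Q (s(aval a s := aval b s)) w" "additive b" "2 * weight a + 2 * weight b + 1 \<le> K"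
  shows "wp (Store a b) K Q s w"
  unfolding wp_def
proof (intro exI conjI allI impI)
  show "exec (Store a b) (s, w) (1 + acost a s + acost b s + bitlen (aval a s) + bitlen (aval b s))
     (s(aval a s := aval b s), w)" by (rule exec.Store)
  show "Q (s(aval a s := aval b s)) w" by fact
  fix L assume L: "fits L s w"
  have "1 + acost a s + acost b s + bitlen (aval a s) + bitlen (aval b s)
     \<le> (2 * weight a + 2 * weight b + 1) * (L + 1)"
    using acost_le[OF L, of a] acost_le[OF L, of b] bitlen_aval[OF L, of a] bitlen_aval[OF L, of b]
    by (simp add: algebra_simps)
  also have "\<dots> \<le> K * (L + K)" by (rule unit_cost_bound) fact
  finally show "1 + acost a s + acost b s + bitlen (aval a s) + bitlen (aval b s) \<le> K * (L + K)" .
  have "aval b s < 2 ^ (L + weight b)" by (rule aval_additive_less) fact+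
  also have "\<dots> \<le> 2 ^ (L + K)" using assms(3) by (intro power_increasing) auto
  finally show "fits (L + K) (s(aval a s := aval b s)) w"
    using fits_mono[OF L, of "L + K"] by (auto simp: fits_def)
qed

text \<open>Since \<open>fits\<close> covers the unread input too, moving a number into memory does
  not raise the bound on lengths.\<close>

lemma wp_Read:
  assumes "Q (s(aval a s := x)) w" "2 * weight a + 2 \<le> K"
  shows "wp (Read a) K Q s (x # w)"
  unfolding wp_def
proof (intro exI conjI allI impI)
  show "exec (Read a) (s, x # w) (1 + acost a s + bitlen (aval a s) + bitlen x)
     (s(aval a s := x), w)" by (rule exec.ReadCons)
  show "Q (s(aval a s := x)) w" by fact
  fix L assume L: "fits L s (x # w)"
  have "x < 2 ^ (L + 1)" using fits_mono[OF L, of "L + 1"] by (simp add: fits_def)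
  then have "bitlen x \<le> L + 1" by (rule bitlen_le) simp
  then have "1 + acost a s + bitlen (aval a s) + bitlen x \<le> (2 * weight a + 2) * (L + 1)"
    using acost_le[OF L, of a] bitlen_aval[OF L, of a] by (simp add: algebra_simps)
  also have "\<dots> \<le> K * (L + K)" by (rule unit_cost_bound) fact
  finally show "1 + acost a s + bitlen (aval a s) + bitlen x \<le> K * (L + K)" .
  show "fits (L + K) (s(aval a s := x)) w"
    using fits_mono[OF L, of "L + K"] by (auto simp: fits_def)
qed

text \<open>The second command starts with numbers of length \<open>L + M\<close>. The resulting
  cross term \<open>M * N\<close> appears twice on the right, so the quadratic bound
  composes.\<close>

lemma step_bound:
  fixes t u :: nat
  assumes "t \<le> M * (L + M)" "u \<le> N * (L + M + N)"
  shows "1 + t + u \<le> (M + N + 1) * (L + (M + N + 1))"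
proof -
  have "M * (L + M) \<le> M * (L + (M + N + 1))" "N * (L + M + N) \<le> N * (L + (M + N + 1))"
    by (intro mult_left_mono; simp)+
  with assms show ?thesis by (simp add: algebra_simps)
qed

lemma wp_Seq:
  assumes "wp c M (wp d N Q) s w"
  shows "wp (Seq c d) (M + N + 1) Q s w"
proof -
  obtain t s1 w1 where 1: "exec c (s, w) t (s1, w1)" "wp d N Q s1 w1"
    "\<And>L. fits L s w \<Longrightarrow> fits (L + M) s1 w1 \<and> t \<le> M * (L + M)"
    using assms unfolding wp_def by blast
  obtain u s2 w2 where 2: "exec d (s1, w1) u (s2, w2)" "Q s2 w2"
    "\<And>L. fits L s1 w1 \<Longrightarrow> fits (L + N) s2 w2 \<and> u \<le> N * (L + N)"
    using 1(2) unfolding wp_def by blast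
  show ?thesis
    unfolding wp_def
  proof (intro exI conjI allI impI)
    show "exec (Seq c d) (s, w) (1 + t + u) (s2, w2)" by (rule exec.Seq[OF 1(1) 2(1)])
    show "Q s2 w2" by fact
    fix L assume "fits L s w"
    note b = 1(3)[OF this] note b2 = 2(3)[OF conjunct1[OF b]]
    show "fits (L + (M + N + 1)) s2 w2" using b2 by (auto elim!: fits_mono)
    show "1 + t + u \<le> (M + N + 1) * (L + (M + N + 1))"
      using b b2 by (intro step_bound) auto
  qed
qed

lemma guard_cost:
  assumes "fits L s w" "weight b + 1 \<le> K"
  shows "1 + acost b s \<le> K * (L + K)"
proof -
  have "1 + acost b s \<le> (weight b + 1) * (L + 1)"
    using acost_le[OF assms(1), of b] by (simp add: algebra_simps)
  with unit_cost_bound[OF assms(2), of L] show ?thesis by linarith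
qed

lemma wp_If:
  assumes "aval b s \<noteq> 0 \<Longrightarrow> wp c M Q s w" "aval b s = 0 \<Longrightarrow> wp d N Q s w" "weight b + 1 \<le> K"
  shows "wp (If b c d) (M + N + K) Q s w"
proof -
  have branch: "wp (If b c d) (R + K) Q s w"
    if ex: "\<And>t s'. exec e (s, w) t s' \<Longrightarrow> exec (If b c d) (s, w) (1 + acost b s + t) s'"
      and e: "wp e R Q s w" for e R
  proof -
    obtain t s1 w1 where 1: "exec e (s, w) t (s1, w1)" "Q s1 w1"
      "\<And>L. fits L s w \<Longrightarrow> fits (L + R) s1 w1 \<and> t \<le> R * (L + R)"
      using e unfolding wp_def by blast
    show ?thesis
      unfolding wp_def
    proof (intro exI conjI allI impI)
      show "exec (If b c d) (s, w) (1 + acost b s + t) (s1, w1)" by (rule ex[OF 1(1)])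
      show "Q s1 w1" by fact
      fix L assume L: "fits L s w"
      show "fits (L + (R + K)) s1 w1" using 1(3)[OF L] by (auto elim!: fits_mono)
      have "K * (L + K) \<le> K * (L + (R + K))" "R * (L + R) \<le> R * (L + (R + K))"
        by (intro mult_left_mono; simp)+
      then show "1 + acost b s + t \<le> (R + K) * (L + (R + K))"
        using 1(3)[OF L] guard_cost[OF L assms(3)] by (simp only: distrib_right) linarith
    qed
  qed
  show ?thesis
  proof (cases "aval b s = 0")
    case True
    show ?thesis
      by (rule wp_mono[OF branch[OF _ assms(2)[OF True]]]) (use exec.IfFalse[of b "(s, w)"] True in auto)
  next
    case False
    show ?thesis
      by (rule wp_mono[OF branch[OF _ assms(1)[OF False]]]) (use exec.IfTrue[of b "(s, w)"] False in auto)
  qed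
qed

lemma wp_WhileFalse:
  assumes "aval b s = 0" "weight b + 1 \<le> K" "Q s w"
  shows "wp (While b c) K Q s w"
  unfolding wp_def
proof (intro exI conjI allI impI)
  show "exec (While b c) (s, w) (1 + acost b s) (s, w)"
    using exec.WhileFalse[of b "(s, w)"] assms(1) by simp
  fix L assume L: "fits L s w"
  show "1 + acost b s \<le> K * (L + K)" by (rule guard_cost[OF L assms(2)])
  show "fits (L + K) s w" using L by (auto elim!: fits_mono)
qed fact

lemma wp_WhileTrue:
  assumes "aval b s \<noteq> 0" "weight b + 1 \<le> K" "wp c M (wp (While b c) N Q) s w"
  shows "wp (While b c) (M + N + K) Q s w"
proof -
  obtain t s1 w1 where 1: "exec c (s, w) t (s1, w1)" "wp (While b c) N Q s1 w1"
    "\<And>L. fits L s w \<Longrightarrow> fits (L + M) s1 w1 \<and> t \<le> M * (L + M)"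
    using assms(3) unfolding wp_def by blast
  obtain u s2 w2 where 2: "exec (While b c) (s1, w1) u (s2, w2)" "Q s2 w2"
    "\<And>L. fits L s1 w1 \<Longrightarrow> fits (L + N) s2 w2 \<and> u \<le> N * (L + N)"
    using 1(2) unfolding wp_def by blast
  show ?thesis
    unfolding wp_def
  proof (intro exI conjI allI impI)
    show "exec (While b c) (s, w) (1 + acost b s + t + u) (s2, w2)"
      using exec.WhileTrue[of b "(s, w)"] assms(1) 1(1) 2(1) by simp
    show "Q s2 w2" by fact
    fix L assume L: "fits L s w"
    note b = 1(3)[OF L] note b2 = 2(3)[OF conjunct1[OF b]]
    show "fits (L + (M + N + K)) s2 w2" using b2 by (auto elim!: fits_mono)
    have "K * (L + K) \<le> K * (L + (M + N + K))" "M * (L + M) \<le> M * (L + (M + N + K))"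
      "N * (L + M + N) \<le> N * (L + (M + N + K))"
      by (intro mult_left_mono; simp)+
    then show "1 + acost b s + t + u \<le> (M + N + K) * (L + (M + N + K))"
      using b b2 guard_cost[OF L assms(2)] by (simp only: distrib_right) linarith
  qed
qed

text \<open>By truncation the guard is nonzero exactly while the counter is below the bound.\<close>

definition For :: "nat \<Rightarrow> aexp \<Rightarrow> com \<Rightarrow> com" where
  "For i e c = Seq (Store (Const i) (Const 0))
     (While (Minus e (Cell (Const i))) (Seq c (Store (Const i) (Plus (Cell (Const i)) (Const 1)))))"

text \<open>\<open>Inv j\<close> describes the head of round \<open>j\<close>, with the counter
  already set, so the body must establish it for the incremented counter. The limits 100 and 40000
  keep the guard within \<open>K\<close>; \<open>K \<le> N\<close> and \<open>1 \<le> z\<close>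
  absorb the overhead even if there is no round.\<close>

lemma wp_For:
  assumes start: "Inv 0 (s(i := 0)) w"
    and step: "\<And>j s w. Inv j s w \<Longrightarrow> s i = j \<Longrightarrow> j < n \<Longrightarrow>
      wp c N (\<lambda>s w. s i = j \<and> Inv (Suc j) (s(i := Suc j)) w) s w"
    and bound: "\<And>j s w. Inv j s w \<Longrightarrow> s i = j \<Longrightarrow> j \<le> n \<Longrightarrow> aval e s = n"
    and fin: "\<And>s w. Inv n s w \<Longrightarrow> s i = n \<Longrightarrow> Q s w"
    and size: "i \<le> 100" "weight e \<le> 40000" and N: "K \<le> N" and n: "n \<le> z" "1 \<le> z"
  shows "wp (For i e c) (8 * (z * N)) Q s w"
proof -
  let ?b = "Minus e (Cell (Const i))"
  let ?c = "Seq c (Store (Const i) (Plus (Cell (Const i)) (Const 1)))"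
  have wb: "weight ?b + 1 \<le> K" using size by (simp add: unit_cost_def)
  have loop: "wp (While ?b ?c) ((n - j) * (N + 2 * K + 1) + K) Q s w"
    if "Inv j s w" "s i = j" "j \<le> n" for j s w
    using that
  proof (induction "n - j" arbitrary: j s w)
    case 0
    then have "j = n" by simp
    moreover have "aval e s = n" by (rule bound) fact+
    ultimately show ?case using 0 wb fin by (intro wp_mono[OF wp_WhileFalse]) auto
  next
    case (Suc k)
    have e: "aval e s = n" by (rule bound) fact+
    have j: "j < n" using Suc by simp
    have k: "n - Suc j = k" using Suc(2) by simp
    have "wp ?c (N + K + 1) (wp (While ?b ?c) (k * (N + 2 * K + 1) + K) Q) s w"
    proof (rule wp_Seq, rule wp_mono[OF step[OF Suc(3,4) j]])
      fix s w assume *: "s i = j \<and> Inv (Suc j) (s(i := Suc j)) w"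
      show "wp (Store (Const i) (Plus (Cell (Const i)) (Const 1))) K
          (wp (While ?b ?c) (k * (N + 2 * K + 1) + K) Q) s w"
      proof (rule wp_Store)
        show "wp (While ?b ?c) (k * (N + 2 * K + 1) + K) Q
          (s(aval (Const i) s := aval (Plus (Cell (Const i)) (Const 1)) s)) w"
          using Suc(1)[of "Suc j" "s(i := Suc j)" w] * k j by simp
      qed (use size in \<open>auto simp: unit_cost_def\<close>)
    qed simp
    then have "wp (While ?b ?c) ((N + K + 1) + (k * (N + 2 * K + 1) + K) + K) Q s w"
      using e j Suc(4) wb by (intro wp_WhileTrue) auto
    then show ?case
      by (rule wp_mono) (simp_all flip: Suc(2))
  qed
  have "wp (For i e c) (K + (n * (N + 2 * K + 1) + K) + 1) Q s w"
    unfolding For_def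
  proof (rule wp_Seq, rule wp_Store)
    show "wp (While ?b ?c) (n * (N + 2 * K + 1) + K) Q (s(aval (Const i) s := aval (Const 0) s)) w"
      using loop[of 0 "s(i := 0)" w] start by simp
  qed (use size in \<open>auto simp: unit_cost_def\<close>)
  then show ?thesis
  proof (rule wp_mono)
    have K: "1 \<le> K" by (simp add: unit_cost_def)
    have "n * (N + 2 * K + 1) \<le> z * (4 * N)" using n N K by (intro mult_mono) auto
    moreover have "1 * K \<le> z * N" "1 * 1 \<le> z * N" using n N K by (intro mult_mono; simp)+
    ultimately show "K + (n * (N + 2 * K + 1) + K) + 1 \<le> 8 * (z * N)" by linarith
  qed
qed

section \<open>Excess of a set system\<close>

text \<open>\<open>C\<close> is the set of clauses still to be covered, the state of the recursion.
  Truncation is harmless because \<open>S = {}\<close> contributes 0.\<close>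

definition excess :: "(nat \<Rightarrow> nat set) \<Rightarrow> nat \<Rightarrow> nat set \<Rightarrow> nat" where
  "excess E n C = Max ((\<lambda>S. card (\<Union>(E ` S) \<inter> C) - card S) ` Pow {..<n})"

lemma excess_ge:
  "S \<subseteq> {..<n} \<Longrightarrow> card (\<Union>(E ` S) \<inter> C) - card S \<le> excess E n C"
  unfolding excess_def by (rule Max_ge) auto

text \<open>A positive maximum involves no truncation, and for 0 the empty set serves. Later
  arguments thus work with a genuine equation.\<close>

lemma excess_attained:
  obtains S where "S \<subseteq> {..<n}" "excess E n C + card S = card (\<Union>(E ` S) \<inter> C)"
proof -
  have "excess E n C \<in> (\<lambda>S. card (\<Union>(E ` S) \<inter> C) - card S) ` Pow {..<n}"
    unfolding excess_def by (rule Max_in) auto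
  then obtain S where S: "S \<subseteq> {..<n}" "excess E n C = card (\<Union>(E ` S) \<inter> C) - card S" by auto
  show thesis
  proof (cases "excess E n C = 0")
    case True
    with that[of "{}"] show thesis by simp
  next
    case False
    with that[OF S(1)] S(2) show thesis by simp
  qed
qed

lemma excess_mono:
  assumes "C \<subseteq> D" "finite D"
  shows "excess E n C \<le> excess E n D"
proof -
  obtain S where S: "S \<subseteq> {..<n}" "excess E n C + card S = card (\<Union>(E ` S) \<inter> C)"
    by (rule excess_attained)
  moreover have "card (\<Union>(E ` S) \<inter> C) \<le> card (\<Union>(E ` S) \<inter> D)"
    using assms by (intro card_mono) auto
  ultimately show ?thesis using excess_ge[OF S(1), of E D] by linarith
qed

text \<open>Add \<open>x\<close> to an optimal set for \<open>C - E x\<close>: it costs at most one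
  variable and covers \<open>C \<inter> E x\<close> on top.\<close>

lemma excess_insert_le:
  assumes "x < n" "finite C"
  shows "excess E n (C - E x) + card (C \<inter> E x) \<le> excess E n C + 1"
proof -
  obtain S where S: "S \<subseteq> {..<n}"
    "excess E n (C - E x) + card S = card (\<Union>(E ` S) \<inter> (C - E x))"
    by (rule excess_attained)
  have "card (\<Union>(E ` S) \<inter> (C - E x)) + card (C \<inter> E x)
      = card (\<Union>(E ` S) \<inter> (C - E x) \<union> (C \<inter> E x))"
    using assms(2) by (intro card_Un_disjoint[symmetric]) auto
  also have "\<dots> \<le> card (\<Union>(E ` insert x S) \<inter> C)"
    using assms(2) by (intro card_mono) auto
  finally have "card (\<Union>(E ` S) \<inter> (C - E x)) + card (C \<inter> E x) \<le> card (\<Union>(E ` insert x S) \<inter> C)" .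
  moreover have "card (insert x S) \<le> card S + 1"
    by (simp add: card_insert_le_m1 card_insert_if S(1) finite_subset)
  ultimately show ?thesis
    using excess_ge[of "insert x S" n E C] S assms(1) by simp
qed

text \<open>Whatever an optimal set covers in \<open>C - E x\<close> is covered without
  \<open>x\<close>.\<close>

lemma excess_remove_ge:
  assumes "S \<subseteq> {..<n}" "excess E n C + card S = card (\<Union>(E ` S) \<inter> C)" "x \<in> S" "finite C"
  shows "excess E n C + 1 \<le> excess E n (C - E x) + card (C \<inter> E x)"
proof -
  let ?S = "S - {x}"
  have fin: "finite S" using assms(1) finite_subset by blast
  have "card (\<Union>(E ` S) \<inter> C) \<le> card ((\<Union>(E ` ?S) \<inter> (C - E x)) \<union> (C \<inter> E x))"
    using assms(4) by (intro card_mono) auto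
  also have "\<dots> \<le> card (\<Union>(E ` ?S) \<inter> (C - E x)) + card (C \<inter> E x)"
    by (rule card_Un_le)
  finally have "card (\<Union>(E ` S) \<inter> C) \<le> card (\<Union>(E ` ?S) \<inter> (C - E x)) + card (C \<inter> E x)" .
  moreover have "card S = card ?S + 1"
    using assms(3) fin by (metis Suc_eq_plus1 card_Suc_Diff1)
  moreover have "card (\<Union>(E ` ?S) \<inter> (C - E x)) - card ?S \<le> excess E n (C - E x)"
    using assms(1) by (intro excess_ge) auto
  ultimately show ?thesis using assms(2) by linarith
qed

text \<open>Together with \<open>excess_insert_le\<close> this is the recurrence of the first stage.
  A nonempty \<open>C \<inter> E x\<close> makes \<open>C - E x\<close> strictly smaller, so the
  recursion is well founded.\<close>

lemma excess_cases:
  assumes "finite C" "excess E n C \<noteq> 0"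
  obtains x where "x < n" "C \<inter> E x \<noteq> {}"
    "excess E n C + 1 \<le> excess E n (C - E x) + card (C \<inter> E x)"
proof -
  obtain S where S: "S \<subseteq> {..<n}" "excess E n C + card S = card (\<Union>(E ` S) \<inter> C)"
    by (rule excess_attained)
  then have "\<Union>(E ` S) \<inter> C \<noteq> {}" using assms(2) by (metis add_is_0 card.empty)
  then obtain x where "x \<in> S" "C \<inter> E x \<noteq> {}" by blast
  with S assms(1) excess_remove_ge[OF S] that show thesis by blast
qed

text \<open>If losing \<open>j\<close> lowers the excess, an optimal set must cover
  \<open>j\<close>, and the variable covering it can be split off.\<close>

lemma excess_delete_cases:
  assumes "finite C" "excess E n (C - {j}) < excess E n C"
  obtains x where "x < n" "j \<in> E x"
    "excess E n C + 1 \<le> excess E n (C - E x) + card (C \<inter> E x)"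
proof -
  obtain S where S: "S \<subseteq> {..<n}" "excess E n C + card S = card (\<Union>(E ` S) \<inter> C)"
    by (rule excess_attained)
  have "j \<in> \<Union>(E ` S)"
  proof (rule ccontr)
    assume "j \<notin> \<Union>(E ` S)"
    then have "\<Union>(E ` S) \<inter> (C - {j}) = \<Union>(E ` S) \<inter> C" by auto
    with excess_ge[OF S(1), of E "C - {j}"] S(2) assms(2) show False by simp
  qed
  then obtain x where "x \<in> S" "j \<in> E x" by blast
  with S assms(1) excess_remove_ge[OF S] that show thesis by blast
qed

text \<open>The clause \<open>j\<close> pays for \<open>x\<close>, which cancels the
  \<open>1\<close> in \<open>excess_insert_le\<close>. As \<open>j\<close> is the only clause of
  \<open>x\<close> outside \<open>U\<close>, the set \<open>J\<close> stays intact.\<close>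

lemma excess_free_ge:
  assumes "x < n" "E x - U = {j}" "B \<subseteq> U" "J \<inter> U = {}" "j \<notin> J" "finite B" "finite J"
  shows "excess E n (B - E x \<union> J) + card (B \<inter> E x) \<le> excess E n (insert j (B \<union> J))"
proof -
  let ?C = "insert j (B \<union> J)"
  have j: "j \<in> E x" "j \<notin> U" "E x \<subseteq> insert j U" using assms(2) by auto
  then have "?C - E x = B - E x \<union> J" "?C \<inter> E x = insert j (B \<inter> E x)" "j \<notin> B"
    using assms(3-5) by auto
  then show ?thesis
    using excess_insert_le[of x n ?C E] assms(1,6,7) by simp
qed

text \<open>Converse of \<open>excess_free_ge\<close>: any gain from admitting \<open>j\<close>
  comes through a variable that hits \<open>j\<close>, and this variable has no other clause outside
  \<open>U\<close>.\<close>

lemma excess_free_cases: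
  assumes "\<And>x. x < n \<Longrightarrow> card (E x - U) \<le> 1" "\<And>x. finite (E x)"
    and "B \<subseteq> U" "J \<inter> U = {}" "j \<notin> J" "j \<notin> U" "finite B" "finite J"
    and "excess E n (B \<union> J) < excess E n (insert j (B \<union> J))"
  obtains x where "x < n" "j \<in> E x"
    "excess E n (insert j (B \<union> J)) \<le> excess E n (B - E x \<union> J) + card (B \<inter> E x)"
proof -
  let ?C = "insert j (B \<union> J)"
  have "?C - {j} = B \<union> J" using assms(3,5,6) by blast
  with assms(7-9) obtain x where x: "x < n" "j \<in> E x"
    "excess E n ?C + 1 \<le> excess E n (?C - E x) + card (?C \<inter> E x)"
    using excess_delete_cases[of ?C E n j] by auto
  have "E x - U = {j}"
    using assms(1)[OF x(1)] assms(2)[of x] x(2) assms(6) by (auto simp: card_le_Suc0_iff_eq)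
  then have "E x \<subseteq> insert j U" by auto
  then have "?C - E x = B - E x \<union> J" "?C \<inter> E x = insert j (B \<inter> E x)" "j \<notin> B"
    using x(2) assms(3-6) by auto
  with x assms(7) that show thesis by simp
qed

section \<open>Subsets encoded as numbers\<close>

text \<open>The positions are existentially quantified because the program stores only the powers of
  two; weight 0 marks a clause outside \<open>U\<close>.\<close>

definition bit_weights :: "(nat \<Rightarrow> nat) \<Rightarrow> nat \<Rightarrow> bool" where
  "bit_weights p u \<longleftrightarrow> (\<exists>pos. bij_betw pos {c. p c \<noteq> 0} {..<u} \<and> (\<forall>c. p c \<noteq> 0 \<longrightarrow> p c = 2 ^ pos c))"

text \<open>For \<open>p c = 0\<close> the quotient is \<open>0\<close>, so \<open>c\<close> is not selected.\<close>

definition selected :: "(nat \<Rightarrow> nat) \<Rightarrow> nat \<Rightarrow> nat set" where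
  "selected p A = {c. odd (A div p c)}"

lemma bit_weights_zero: "bit_weights (\<lambda>_. 0) 0"
  by (simp add: bit_weights_def bij_betw_def)

lemma bit_weights_add:
  assumes "bit_weights p u" "p c = 0"
  shows "bit_weights (p(c := 2 ^ u)) (Suc u)"
proof -
  obtain pos where pos: "bij_betw pos {c. p c \<noteq> 0} {..<u}" "\<And>c. p c \<noteq> 0 \<Longrightarrow> p c = 2 ^ pos c"
    using assms(1) by (auto simp: bit_weights_def)
  have "bij_betw (pos(c := u)) {c. p c \<noteq> 0} {..<u}"
    using pos(1) assms(2) by (subst bij_betw_cong[of _ _ pos]) auto
  then have "bij_betw (pos(c := u)) ({c. p c \<noteq> 0} \<union> {c}) ({..<u} \<union> {u})"
    by (rule bij_betw_combine) (auto simp: bij_betw_def)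
  moreover have "{c'. (p(c := 2 ^ u)) c' \<noteq> 0} = {c. p c \<noteq> 0} \<union> {c}" by auto
  moreover have "{..<Suc u} = {..<u} \<union> {u}" by auto
  ultimately have "bij_betw (pos(c := u)) {c'. (p(c := 2 ^ u)) c' \<noteq> 0} {..<Suc u}" by metis
  then show ?thesis
    unfolding bit_weights_def using pos(2) by (intro exI[of _ "pos(c := u)"]) auto
qed

lemma selected_subset: "selected p A \<subseteq> {c. p c \<noteq> 0}"
  by (auto simp: selected_def intro!: gr0I)

lemma bit_weights_finite: "bit_weights p u \<Longrightarrow> finite {c. p c \<noteq> 0}"
  unfolding bit_weights_def by (metis bij_betw_finite finite_lessThan)

lemma bit_weights_card: "bit_weights p u \<Longrightarrow> card {c. p c \<noteq> 0} = u"
  unfolding bit_weights_def by (metis bij_betw_same_card card_lessThan)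

lemma bit_weights_full:
  assumes "bit_weights p u"
  shows "selected p (2 ^ u - 1) = {c. p c \<noteq> 0}"
proof -
  obtain pos where pos: "bij_betw pos {c. p c \<noteq> 0} {..<u}" "\<And>c. p c \<noteq> 0 \<Longrightarrow> p c = 2 ^ pos c"
    using assms by (auto simp: bit_weights_def)
  have "set_encode {..<u} = 2 ^ u - 1"
    by (simp add: set_encode_def lessThan_atLeast0 sum_power2)
  then have dec: "set_decode (2 ^ u - 1) = {..<u}" by (metis finite_lessThan set_encode_inverse)
  have "odd ((2 ^ u - 1) div p c)" if "p c \<noteq> 0" for c
  proof -
    have "pos c \<in> set_decode (2 ^ u - 1)"
      using dec bij_betwE[OF pos(1)] that by blast
    then show ?thesis using pos(2)[OF that] by (simp add: set_decode_def)
  qed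
  then show ?thesis using selected_subset[of p "2 ^ u - 1"] by (auto simp: selected_def)
qed

text \<open>Every subtracted power of two is a bit set in \<open>A\<close>, so no borrow occurs and
  subtraction is set difference.\<close>

lemma selected_diff:
  assumes "bit_weights p u"
  shows "selected p (A - sum p (selected p A \<inter> X)) = selected p A - X"
    and "sum p (selected p A \<inter> X) \<le> A"
proof -
  let ?U = "{c. p c \<noteq> 0}" and ?B = "selected p A"
  obtain pos where pos: "bij_betw pos ?U {..<u}" "\<And>c. p c \<noteq> 0 \<Longrightarrow> p c = 2 ^ pos c"
    using assms by (auto simp: bit_weights_def)
  have sel: "selected p A = {c \<in> ?U. pos c \<in> set_decode A}" for A
    using pos(2) selected_subset[of p A] by (auto simp: selected_def set_decode_def)
  have BU: "?B \<subseteq> ?U" by (rule selected_subset)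
  have inj: "inj_on pos ?U" using pos(1) by (rule bij_betw_imp_inj_on)
  let ?P = "pos ` (?B \<inter> X)"
  have P: "?P \<subseteq> set_decode A" using sel by auto
  have "sum p (?B \<inter> X) = (\<Sum>c\<in>?B \<inter> X. 2 ^ pos c)"
    using BU pos(2) by (intro sum.cong) auto
  also have "\<dots> = set_encode ?P"
    unfolding set_encode_def using BU
    by (subst sum.reindex) (auto intro: inj_on_subset[OF inj])
  finally have s: "sum p (?B \<inter> X) = set_encode ?P" .
  have "A = set_encode (set_decode A)" by simp
  also have "\<dots> = set_encode (set_decode A - ?P) + set_encode ?P"
    unfolding set_encode_def using P by (intro sum.subset_diff) auto
  finally have A: "A = set_encode (set_decode A - ?P) + set_encode ?P" .
  then show "sum p (?B \<inter> X) \<le> A" using s by linarith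
  have "A - sum p (?B \<inter> X) = set_encode (set_decode A - ?P)" using A s by linarith
  then have "selected p (A - sum p (?B \<inter> X)) = {c \<in> ?U. pos c \<in> set_decode A - ?P}"
    unfolding sel by simp
  also have "\<dots> = ?B - X"
  proof -
    have "pos c \<in> ?P \<longleftrightarrow> c \<in> ?B \<inter> X" if "c \<in> ?U" for c
      by (rule inj_on_image_mem_iff[OF inj that]) (use BU in auto)
    then show ?thesis unfolding sel[of A] by auto
  qed
  finally show "selected p (A - sum p (?B \<inter> X)) = ?B - X" .
qed

text \<open>Removing clauses lowers the number, so numerical order is a valid order of evaluation
  for the table.\<close>

lemma selected_sum_pos:
  assumes "bit_weights p u" "selected p A \<inter> X \<noteq> {}"
  shows "A - sum p (selected p A \<inter> X) < A"
proof -
  obtain c where c: "c \<in> selected p A \<inter> X" using assms(2) by blast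
  have "finite (selected p A \<inter> X)"
    using bit_weights_finite[OF assms(1)] selected_subset finite_subset by (metis finite_Int)
  then have "p c \<le> sum p (selected p A \<inter> X)" using c by (intro member_le_sum) auto
  moreover have "p c \<noteq> 0" using c selected_subset[of p A] by auto
  moreover have "sum p (selected p A \<inter> X) \<le> A" by (rule selected_diff(2)[OF assms(1)])
  ultimately show ?thesis by linarith
qed

section \<open>Satisfiability as maximum excess\<close>

text \<open>Clauses are represented by list positions, so that repeated clauses count separately;
  \<open>2 * x + 1\<close> is the code of a negative literal.\<close>

definition hits :: "nat list list \<Rightarrow> nat \<Rightarrow> nat set" where
  "hits rows x = {i. i < length rows \<and> 2 * x + 1 \<in> set (rows ! i)}"

lemma finite_vars: "is_cnf F \<Longrightarrow> finite (vars F)"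
  by (auto simp: vars_def is_cnf_def is_clause_def clause_vars_def)

lemma size_filter_map_set:
  "size (filter_mset P (mset (map set cs))) = card {i. i < length cs \<and> P (set (cs ! i))}"
proof -
  have "filter_mset P (mset (map set cs)) = mset (filter P (map set cs))" by simp
  then have "size (filter_mset P (mset (map set cs))) = length (filter P (map set cs))"
    by (metis size_mset)
  also have "\<dots> = card {i. i < length cs \<and> P (set (cs ! i))}"
    by (auto simp: length_filter_conv_card intro!: arg_cong[where f = card])
  finally show ?thesis .
qed

text \<open>The satisfied clauses split into the unit clauses of true variables and the clauses hit
  by false ones. The parts are disjoint because a clause with a positive literal has no other
  literal, and the first part has one clause per true variable by
  \<open>occ F (Pos v) = 1\<close>.\<close>

lemma special_satisfied:
  fixes F :: "'v cnf" and \<tau> :: "'v \<Rightarrow> bool"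
  assumes F: "transformed_special_instance F \<alpha>" and num: "bij_betw num (vars F) {..<n}"
    and cs: "mset (map set cs) = F"
  defines "E \<equiv> hits (map (map (lit_code num)) cs)"
    and "S \<equiv> num ` {v \<in> vars F. \<not> \<tau> v}"
  shows "size (filter_mset (satisfies \<tau>) F) + card S = n + card (\<Union>(E ` S))"
proof -
  have cnf: "is_cnf F" and occ1: "\<And>x. x \<in> vars F \<Longrightarrow> occ F (Pos x) = 1"
    and unit: "\<And>x c. x \<in> vars F \<Longrightarrow> c \<in># F \<Longrightarrow> Pos x \<in> c \<Longrightarrow> c = {Pos x}"
    using F by (auto simp: transformed_special_instance_def)
  have inF: "set (cs ! i) \<in># F" if "i < length cs" for i
    using that cs by (metis in_set_conv_nth length_map nth_map set_mset_mset)
  have var: "v \<in> vars F" if "i < length cs" "l \<in> set (cs ! i)" "var l = v" for i l v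
    using inF[OF that(1)] that(2,3) by (auto simp: vars_def clause_vars_def)
  have inj: "inj_on num (vars F)" using num by (rule bij_betw_imp_inj_on)
  have fin: "finite (vars F)" by (rule finite_vars[OF cnf])
  have n: "card (vars F) = n" using bij_betw_same_card[OF num] by simp
  let ?T = "{v \<in> vars F. \<tau> v}"
  let ?Q = "\<lambda>v. {i. i < length cs \<and> Pos v \<in> set (cs ! i)}"
  have hitE: "i \<in> E (num v) \<longleftrightarrow> i < length cs \<and> Neg v \<in> set (cs ! i)" if "v \<in> vars F" for i v
  proof -
    have code: "2 * num v + 1 = lit_code num l \<longleftrightarrow> l = Neg v" if "var l \<in> vars F" for l
    proof (cases l)
      case (Pos x)
      have "2 * num v + 1 \<noteq> 2 * num x" by presburger
      with Pos show ?thesis by simp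
    next
      case (Neg x)
      then have "num v = num x \<longleftrightarrow> v = x"
        using that \<open>v \<in> vars F\<close> by (intro inj_on_eq_iff[OF inj]) auto
      with Neg show ?thesis by auto
    qed
    have "2 * num v + 1 \<in> lit_code num ` set (cs ! i) \<longleftrightarrow> Neg v \<in> set (cs ! i)" if "i < length cs"
    proof
      assume "2 * num v + 1 \<in> lit_code num ` set (cs ! i)"
      then obtain l where l: "2 * num v + 1 = lit_code num l" "l \<in> set (cs ! i)" by (rule imageE)
      with code[OF var[OF that l(2) refl]] show "Neg v \<in> set (cs ! i)" by simp
    next
      assume "Neg v \<in> set (cs ! i)"
      then show "2 * num v + 1 \<in> lit_code num ` set (cs ! i)" by (rule rev_image_eqI) simp
    qed
    then show ?thesis unfolding E_def hits_def by (auto simp: nth_map)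
  qed
  have sat: "{i. i < length cs \<and> satisfies \<tau> (set (cs ! i))} = \<Union>(?Q ` ?T) \<union> \<Union>(E ` S)"
  proof -
    have "satisfies \<tau> (set (cs ! i)) \<longleftrightarrow> (\<exists>v\<in>?T. Pos v \<in> set (cs ! i)) \<or> (\<exists>v\<in>{v \<in> vars F. \<not> \<tau> v}. Neg v \<in> set (cs ! i))"
      if i: "i < length cs" for i
    proof
      assume "satisfies \<tau> (set (cs ! i))"
      then obtain l where l: "l \<in> set (cs ! i)" "lit_true \<tau> l" by (auto simp: satisfies_def)
      with var[OF i l(1) refl] show "(\<exists>v\<in>?T. Pos v \<in> set (cs ! i)) \<or> (\<exists>v\<in>{v \<in> vars F. \<not> \<tau> v}. Neg v \<in> set (cs ! i))"
        by (cases l) auto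
    next
      assume "(\<exists>v\<in>?T. Pos v \<in> set (cs ! i)) \<or> (\<exists>v\<in>{v \<in> vars F. \<not> \<tau> v}. Neg v \<in> set (cs ! i))"
      then show "satisfies \<tau> (set (cs ! i))" unfolding satisfies_def
        by (metis (mono_tags, lifting) lit_true.simps mem_Collect_eq)
    qed
    moreover have "\<Union>(E ` S) = {i. i < length cs \<and> (\<exists>v\<in>{v \<in> vars F. \<not> \<tau> v}. Neg v \<in> set (cs ! i))}"
      unfolding S_def using hitE by auto
    ultimately show ?thesis by auto
  qed
  have disj: "\<Union>(?Q ` ?T) \<inter> \<Union>(E ` S) = {}"
  proof (rule ccontr)
    assume "\<Union>(?Q ` ?T) \<inter> \<Union>(E ` S) \<noteq> {}"
    then obtain i v v' where i: "i < length cs" "v \<in> vars F" "Pos v \<in> set (cs ! i)"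
      and v': "v' \<in> vars F" "i \<in> E (num v')"
      unfolding S_def by blast
    have "Neg v' \<in> set (cs ! i)" using v' hitE by blast
    with unit[OF i(2) inF[OF i(1)] i(3)] show False by simp
  qed
  have "card (\<Union>(?Q ` ?T)) = (\<Sum>v\<in>?T. card (?Q v))"
  proof (rule card_UN_disjoint)
    show "\<forall>v\<in>?T. \<forall>v'\<in>?T. v \<noteq> v' \<longrightarrow> ?Q v \<inter> ?Q v' = {}"
    proof (intro ballI impI)
      fix v v' assume v: "v \<in> ?T" "v' \<in> ?T" "v \<noteq> v'"
      show "?Q v \<inter> ?Q v' = {}"
      proof (rule ccontr)
        assume "?Q v \<inter> ?Q v' \<noteq> {}"
        then obtain i where i: "i < length cs" "Pos v \<in> set (cs ! i)" "Pos v' \<in> set (cs ! i)" by blast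
        have "set (cs ! i) = {Pos v}" using unit[OF _ inF[OF i(1)] i(2)] v(1) by simp
        with i(3) v(3) show False by simp
      qed
    qed
  qed (use fin in auto)
  also have "\<dots> = (\<Sum>v\<in>?T. 1)"
  proof (rule sum.cong)
    fix v assume "v \<in> ?T"
    then have "occ F (Pos v) = 1" using occ1 by simp
    then show "card (?Q v) = 1" unfolding occ_def cs[symmetric] size_filter_map_set .
  qed simp
  finally have cT: "card (\<Union>(?Q ` ?T)) = card ?T" by simp
  have "card ?T + card {v \<in> vars F. \<not> \<tau> v} = card (?T \<union> {v \<in> vars F. \<not> \<tau> v})"
    using fin by (intro card_Un_disjoint[symmetric]) auto
  moreover have "?T \<union> {v \<in> vars F. \<not> \<tau> v} = vars F" by auto
  moreover have "card S = card {v \<in> vars F. \<not> \<tau> v}"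
    unfolding S_def by (intro card_image inj_on_subset[OF inj]) auto
  ultimately have "card ?T + card S = n" using n by simp
  moreover have card: "card (\<Union>(?Q ` ?T) \<union> \<Union>(E ` S)) = card (\<Union>(?Q ` ?T)) + card (\<Union>(E ` S))"
  proof (rule card_Un_disjoint[OF _ _ disj])
    have "\<Union>(?Q ` ?T) \<union> \<Union>(E ` S) \<subseteq> {..<length cs}" unfolding sat[symmetric] by auto
    then have "finite (\<Union>(?Q ` ?T) \<union> \<Union>(E ` S))" by (rule finite_subset) simp
    then show "finite (\<Union>(?Q ` ?T))" "finite (\<Union>(E ` S))" unfolding finite_Un by blast+
  qed
  ultimately show ?thesis
    using size_filter_map_set[of "satisfies \<tau>" cs] unfolding cs sat card cT by linarith
qed

text \<open>If \<open>\<alpha> \<le> n\<close>, both sides hold: the all-true assignment satisfies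
  \<open>n\<close> clauses, and the truncated difference is 0.\<close>

lemma special_sat_iff:
  fixes F :: "'v cnf"
  assumes F: "transformed_special_instance F \<alpha>" and num: "bij_betw num (vars F) {..<n}"
    and cs: "mset (map set cs) = F"
  defines "E \<equiv> hits (map (map (lit_code num)) cs)"
  shows "sat F \<ge> \<alpha> \<longleftrightarrow> \<alpha> - n \<le> excess E n {..<length cs}"
proof -
  have E: "\<Union>(E ` S) \<inter> {..<length cs} = \<Union>(E ` S)" for S
    by (auto simp: E_def hits_def)
  have "sat F \<ge> \<alpha> \<longleftrightarrow> (\<exists>\<tau>. \<alpha> \<le> size (filter_mset (satisfies \<tau>) F))"
    unfolding sat_def by (subst Max_ge_iff[OF finite_sat_values]) auto
  also have "\<dots> \<longleftrightarrow> (\<exists>S\<subseteq>{..<n}. \<alpha> + card S \<le> n + card (\<Union>(E ` S)))"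
  proof
    assume "\<exists>\<tau>. \<alpha> \<le> size (filter_mset (satisfies \<tau>) F)"
    then obtain \<tau> where "\<alpha> \<le> size (filter_mset (satisfies \<tau>) F)" by blast
    with special_satisfied[OF F num cs, of \<tau>]
    have "\<alpha> + card (num ` {v \<in> vars F. \<not> \<tau> v}) \<le> n + card (\<Union>(E ` num ` {v \<in> vars F. \<not> \<tau> v}))"
      unfolding E_def by linarith
    moreover have "num ` {v \<in> vars F. \<not> \<tau> v} \<subseteq> {..<n}" using bij_betw_imp_surj_on[OF num] by auto
    ultimately show "\<exists>S\<subseteq>{..<n}. \<alpha> + card S \<le> n + card (\<Union>(E ` S))" by blast
  next
    assume "\<exists>S\<subseteq>{..<n}. \<alpha> + card S \<le> n + card (\<Union>(E ` S))"
    then obtain S where S: "S \<subseteq> {..<n}" "\<alpha> + card S \<le> n + card (\<Union>(E ` S))" by blast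
    \<comment> \<open>The assignment realising \<open>S\<close> makes false exactly the variables
      numbered in \<open>S\<close>.\<close>
    have im: "num ` {v \<in> vars F. \<not> num v \<notin> S} = S" using S(1) bij_betw_imp_surj_on[OF num] by auto
    have "\<alpha> \<le> size (filter_mset (satisfies (\<lambda>v. num v \<notin> S)) F)"
      using S(2) special_satisfied[OF F num cs, of "\<lambda>v. num v \<notin> S"]
      unfolding E_def[symmetric] im by linarith
    then show "\<exists>\<tau>. \<alpha> \<le> size (filter_mset (satisfies \<tau>) F)" by blast
  qed
  also have "\<dots> \<longleftrightarrow> \<alpha> - n \<le> excess E n {..<length cs}"
  proof
    assume "\<exists>S\<subseteq>{..<n}. \<alpha> + card S \<le> n + card (\<Union>(E ` S))"
    then obtain S where S: "S \<subseteq> {..<n}" "\<alpha> + card S \<le> n + card (\<Union>(E ` S))" by blast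
    then show "\<alpha> - n \<le> excess E n {..<length cs}"
      using excess_ge[OF S(1), of E "{..<length cs}"] unfolding E by linarith
  next
    assume le: "\<alpha> - n \<le> excess E n {..<length cs}"
    obtain S where S: "S \<subseteq> {..<n}" "excess E n {..<length cs} + card S = card (\<Union>(E ` S))"
      using excess_attained[of n E "{..<length cs}"] unfolding E by blast
    with le have "\<alpha> + card S \<le> n + card (\<Union>(E ` S))" by linarith
    with S(1) show "\<exists>S\<subseteq>{..<n}. \<alpha> + card S \<le> n + card (\<Union>(E ` S))" by blast
  qed
  finally show ?thesis .
qed

text \<open>Mapping the edges of a matching to their variables is injective. Hence
  \<open>\<alpha> - n\<close> is at most the parameter, and a time bound in the former carries over
  to the latter.\<close>

lemma matching_number_le_vars:
  assumes "is_cnf F"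
  shows "matching_number F \<le> card (vars F)"
proof -
  have "card M \<le> card (vars F)" if M: "matching (incidence_edges F) M" for M
  proof -
    let ?f = "\<lambda>e. SOME v. (Inl v :: 'a + 'a clause \<times> nat) \<in> e"
    have ex: "\<exists>v. Inl v \<in> e" and vars: "Inl v \<in> e \<Longrightarrow> v \<in> vars F" if "e \<in> M" for e v
    proof -
      from that M obtain u c i where e: "e = {Inl u, Inr (c, i)}" "i < count F c" "u \<in> clause_vars c"
        by (auto simp: matching_def incidence_edges_def)
      then have "c \<in># F" by (metis count_inI less_zeroE)
      with e show "\<exists>v. Inl v \<in> e" "Inl v \<in> e \<Longrightarrow> v \<in> vars F" by (auto simp: vars_def)
    qed
    have f: "Inl (?f e) \<in> e" if "e \<in> M" for e using ex[OF that] by (rule someI_ex)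
    have "inj_on ?f M"
    proof (rule inj_onI, rule ccontr)
      fix e e' assume e: "e \<in> M" "e' \<in> M" "?f e = ?f e'" "e \<noteq> e'"
      then have "disjnt e e'" using M by (auto simp: matching_def pairwise_def)
      with f[OF e(1)] f[OF e(2)] e(3) show False by (auto simp: disjnt_iff)
    qed
    moreover have "?f ` M \<subseteq> vars F" using f vars by blast
    ultimately show ?thesis using finite_vars[OF assms] by (rule card_inj_on_le)
  qed
  moreover have "matching (incidence_edges F) {}" by (simp add: matching_def)
  then have "{card M | M. matching (incidence_edges F) M} \<noteq> {}" by blast
  ultimately show ?thesis
    unfolding matching_number_def using finite_matching_sizes[OF assms]
    by (subst Max_le_iff) auto
qed

section \<open>The program\<close>

text \<open>Registers: \<open>0\<close> answer, \<open>1\<close> the parameter \<open>\<alpha> - n\<close>, \<open>2\<close> \<open>n\<close>, \<open>3\<close> \<open>m\<close>, \<open>4\<close> current clause, \<open>5\<close> current variable,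
  \<open>6\<close>--\<open>8\<close> scratch while reading, \<open>9\<close> number of new clauses, \<open>10\<close> \<open>|U|\<close>, \<open>11\<close> size of the greedy set,
  \<open>12\<close> \<open>2\<close> to the power \<open>|U|\<close>, \<open>13\<close> current subset \<open>A\<close> of \<open>U\<close> (as a number), \<open>14\<close> \<open>A\<close> without the clauses of
  the current variable, \<open>15\<close> number of clauses removed, \<open>16\<close> current outside clause, \<open>17\<close> loop counter.
  Three interleaved arrays follow: the incidence matrix, the weights (a power of two for a clause
  in \<open>U\<close>, otherwise \<open>0\<close>), and the table of the dynamic program.\<close>

abbreviation Reg :: "nat \<Rightarrow> aexp" where "Reg i \<equiv> Cell (Const i)"

text \<open>Interleaving yields unbounded arrays; the length of the table becomes known only at run
  time.\<close>

definition addrI :: "nat \<Rightarrow> nat" where "addrI i = 20 + 3 * i"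
definition addrP :: "nat \<Rightarrow> nat" where "addrP i = 21 + 3 * i"
definition addrT :: "nat \<Rightarrow> nat" where "addrT i = 22 + 3 * i"

definition refI :: "aexp \<Rightarrow> aexp" where "refI e = Plus (Const 20) (Times (Const 3) e)"
definition refP :: "aexp \<Rightarrow> aexp" where "refP e = Plus (Const 21) (Times (Const 3) e)"
definition refT :: "aexp \<Rightarrow> aexp" where "refT e = Plus (Const 22) (Times (Const 3) e)"

lemma aval_ref [simp]:
  "aval (refI e) s = addrI (aval e s)" "aval (refP e) s = addrP (aval e s)"
  "aval (refT e) s = addrT (aval e s)"
  by (simp_all add: refI_def refP_def refT_def addrI_def addrP_def addrT_def)

lemma weight_ref [simp]:
  "weight (refI e) = 61 + 4 * weight e" "weight (refP e) = 63 + 4 * weight e"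
  "weight (refT e) = 65 + 4 * weight e"
  by (simp_all add: refI_def refP_def refT_def)

text \<open>The three kinds of addresses differ modulo 3.\<close>

lemma addr_distinct [simp]:
  "addrI i = addrI j \<longleftrightarrow> i = j" "addrP i = addrP j \<longleftrightarrow> i = j" "addrT i = addrT j \<longleftrightarrow> i = j"
  "addrI i \<noteq> addrP j" "addrI i \<noteq> addrT j" "addrP i \<noteq> addrI j"
  "addrP i \<noteq> addrT j" "addrT i \<noteq> addrI j" "addrT i \<noteq> addrP j"
  unfolding addrI_def addrP_def addrT_def by presburger+

lemma addr_low [simp]:
  "r < 20 \<Longrightarrow> addrI i \<noteq> r" "r < 20 \<Longrightarrow> addrP i \<noteq> r" "r < 20 \<Longrightarrow> addrT i \<noteq> r"
  "r < 20 \<Longrightarrow> r \<noteq> addrI i" "r < 20 \<Longrightarrow> r \<noteq> addrP i" "r < 20 \<Longrightarrow> r \<noteq> addrT i"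
  by (auto simp: addrI_def addrP_def addrT_def)

text \<open>The machine has no remainder operation. Because of its product this expression is not
  additive; it occurs in guards only.\<close>

definition odd_part :: "aexp \<Rightarrow> aexp" where
  "odd_part e = Minus e (Times (Const 2) (Div e (Const 2)))"

lemma aval_odd_part [simp]: "aval (odd_part e) s = aval e s mod 2"
  by (simp add: odd_part_def minus_mult_div_eq_mod)

lemma weight_odd_part [simp]: "weight (odd_part e) = 43 + 10 * weight e"
  by (simp add: odd_part_def)

definition entry :: "aexp \<Rightarrow> aexp \<Rightarrow> aexp" where
  "entry c x = refI (Plus (Times c (Reg 2)) x)"

lemma aval_entry [simp]: "aval (entry c x) s = addrI (aval c s * s 2 + aval x s)"
  by (simp add: entry_def)

lemma weight_entry [simp]: "weight (entry c x) = 185 + 16 * weight c + 8 * weight x"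
  by (simp add: entry_def)

text \<open>Codes of positive literals are even and are skipped: their unit clauses are accounted
  for by the term \<open>n\<close> in \<open>\<alpha> - n\<close>.\<close>

definition read_input :: com where
  "read_input = Seq (Read (Const 1)) (Seq (Read (Const 2)) (Seq (Read (Const 3))
     (Seq (Store (Const 1) (Minus (Reg 1) (Reg 2)))
       (For 4 (Reg 3) (Seq (Read (Const 6)) (For 7 (Reg 6)
         (Seq (Read (Const 8))
           (If (odd_part (Reg 8)) (Store (entry (Reg 4) (Div (Reg 8) (Const 2))) (Const 1)) Skip))))))))"

text \<open>The product is a conjunction; by truncation its second factor is 1 exactly for weight
  0.\<close>

definition uncovered :: aexp where
  "uncovered = Times (Cell (entry (Reg 4) (Reg 5))) (Minus (Const 1) (Cell (refP (Reg 4))))"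

definition count_new :: com where
  "count_new = Seq (Store (Const 9) (Const 0))
     (For 4 (Reg 3) (If uncovered (Store (Const 9) (Plus (Reg 9) (Const 1))) Skip))"

definition add_new :: com where
  "add_new = Seq (Store (Const 11) (Plus (Reg 11) (Const 1)))
     (For 4 (Reg 3) (If uncovered
       (Seq (Store (refP (Reg 4)) (Reg 12)) (Seq (Store (Const 12) (Plus (Reg 12) (Reg 12)))
         (Store (Const 10) (Plus (Reg 10) (Const 1))))) Skip))"

text \<open>One pass suffices: \<open>U\<close> only grows, so a variable once rejected never gets a
  second new clause.\<close>

definition greedy :: com where
  "greedy = Seq (Store (Const 12) (Const 1))
     (For 5 (Reg 2) (Seq count_new (If (Minus (Reg 9) (Const 1)) add_new Skip)))"

text \<open>Membership is tested against register 13, which stays fixed while register 14 is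
  reduced.\<close>

definition split_mask :: com where
  "split_mask = Seq (Store (Const 14) (Reg 13)) (Seq (Store (Const 15) (Const 0))
     (For 4 (Reg 3)
       (If (Times (Cell (entry (Reg 4) (Reg 5))) (odd_part (Div (Reg 13) (Cell (refP (Reg 4))))))
         (Seq (Store (Const 14) (Minus (Reg 14) (Cell (refP (Reg 4)))))
           (Store (Const 15) (Plus (Reg 15) (Const 1)))) Skip)))"

definition candidate :: "nat \<Rightarrow> aexp" where
  "candidate d = Minus (Plus (Cell (refT (Reg 14))) (Reg 15)) (Const d)"

definition improve :: "nat \<Rightarrow> com" where
  "improve d = Seq split_mask
     (If (Minus (candidate d) (Cell (refT (Reg 13)))) (Store (refT (Reg 13)) (candidate d)) Skip)"

definition stage1 :: com where
  "stage1 = For 13 (Reg 12) (For 5 (Reg 2) (improve 1))"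

definition stage2_inner :: com where
  "stage2_inner = For 5 (Reg 2) (If (Cell (entry (Reg 16) (Reg 5))) (improve 0) Skip)"

text \<open>Descending order, so that the entries of smaller subsets still are those of the previous round.\<close>

definition stage2_pass :: com where
  "stage2_pass = For 17 (Reg 12)
     (Seq (Store (Const 13) (Minus (Reg 12) (Plus (Reg 17) (Const 1)))) stage2_inner)"

definition stage2 :: com where
  "stage2 = For 16 (Reg 3) (If (Cell (refP (Reg 16))) Skip stage2_pass)"

text \<open>The added 1 makes the test non-strict: it succeeds iff \<open>k + t \<le> |U|\<close>,
  when the greedy set is a witness. The last expression is 1 iff \<open>k\<close> is at most the
  entry of the full set, whose number is \<open>2 ^ |U| - 1\<close>.\<close>

definition decide :: com where
  "decide = If (Minus (Plus (Reg 10) (Const 1)) (Plus (Reg 1) (Reg 11))) (Store (Const 0) (Const 1))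
       (Seq stage1 (Seq stage2
         (Store (Const 0) (Minus (Const 1) (Minus (Reg 1) (Cell (refT (Minus (Reg 12) (Const 1)))))))))"

definition solver :: com where
  "solver = Seq read_input (Seq greedy decide)"

section \<open>Correctness and running time\<close>

definition agree :: "nat set \<Rightarrow> memory \<Rightarrow> memory \<Rightarrow> bool" where
  "agree R s s' \<longleftrightarrow> (\<forall>a. a \<notin> R \<longrightarrow> s' a = s a)"

lemma agreeD: "agree R s s' \<Longrightarrow> a \<notin> R \<Longrightarrow> s' a = s a"
  by (simp add: agree_def)

text \<open>A single \<open>z\<close> bounds both dimensions, so that costs become multiples of
  powers of \<open>z\<close>.\<close>

locale incidence =
  fixes E :: "nat \<Rightarrow> nat set" and n m z k :: nat
  assumes E_sub: "\<And>x. E x \<subseteq> {..<m}" and nz: "n \<le> z" and mz: "m \<le> z" and z1: "1 \<le> z"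
begin

lemma finite_E: "finite (E x)"
  using E_sub finite_subset by blast

lemma Kz: "K \<le> K * z" "1 \<le> K * z" "1 \<le> K"
proof -
  show "1 \<le> K" by (simp add: unit_cost_def)
  moreover show "K \<le> K * z" using z1 by simp
  ultimately show "1 \<le> K * z" by linarith
qed

text \<open>Cells that may change while instance, weights and \<open>2 ^ u\<close> stay fixed. Only
  reading and the greedy phase write elsewhere.\<close>

definition scratch :: "nat set" where
  "scratch = {0, 4, 5, 9, 10, 11, 13, 14, 15, 16, 17} \<union> range addrT"

definition core :: "(nat \<Rightarrow> nat) \<Rightarrow> nat \<Rightarrow> memory \<Rightarrow> bool" where
  "core p u s \<longleftrightarrow> s 1 = k \<and> s 2 = n \<and> s 3 = m \<and> s 12 = 2 ^ u \<and>
     (\<forall>c<m. \<forall>x<n. s (addrI (c * n + x)) = (if c \<in> E x then 1 else 0)) \<and>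
     (\<forall>c. s (addrP c) = p c) \<and> {c. p c \<noteq> 0} \<subseteq> {..<m} \<and> bit_weights p u"

lemma coreD:
  assumes "core p u s"
  shows "s 1 = k" "s 2 = n" "s 3 = m" "s 12 = 2 ^ u" "s (addrP c) = p c"
    "{c. p c \<noteq> 0} \<subseteq> {..<m}" "bit_weights p u"
    "c < m \<Longrightarrow> x < n \<Longrightarrow> s (addrI (c * n + x)) = (if c \<in> E x then 1 else 0)"
  using assms by (auto simp: core_def)

lemma core_agree:
  assumes "core p u s" "agree R s s'" "R \<subseteq> scratch"
  shows "core p u s'"
proof -
  have "s' a = s a" if "a \<notin> scratch" for a using assms that by (auto simp: agree_def)
  moreover have "addrI i \<notin> scratch" "addrP i \<notin> scratch" "1 \<notin> scratch" "2 \<notin> scratch"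
    "3 \<notin> scratch" "12 \<notin> scratch" for i
    by (auto simp: scratch_def)
  ultimately show ?thesis using assms(1) unfolding core_def by metis
qed

lemma core_upd:
  "core p u s \<Longrightarrow> i \<in> scratch \<Longrightarrow> core p u (s(i := v))"
  by (rule core_agree[of p u s "{i}"]) (auto simp: agree_def)

lemma scratch_mem [simp]:
  "0 \<in> scratch" "4 \<in> scratch" "5 \<in> scratch" "9 \<in> scratch" "10 \<in> scratch" "11 \<in> scratch"
  "13 \<in> scratch" "14 \<in> scratch" "15 \<in> scratch" "16 \<in> scratch" "17 \<in> scratch" "addrT i \<in> scratch"
  by (auto simp: scratch_def)

lemma wp_split_mask:
  assumes core: "core p u s" and x: "s 5 = x" "x < n"
  defines "X \<equiv> selected p (s 13) \<inter> E x"
  shows "wp split_mask (60 * (K * z)) (\<lambda>s' w. agree {4, 14, 15} s s' \<and>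
    s' 14 = s 13 - sum p X \<and> s' 15 = card X) s w"
proof -
  define Inv where "Inv = (\<lambda>c s' (w :: nat list). agree {4, 14, 15} s s' \<and>
    s' 14 = s 13 - sum p (X \<inter> {..<c}) \<and> s' 15 = card (X \<inter> {..<c}))"
  have Xm: "X \<inter> {..<m} = X" using E_sub unfolding X_def by auto
  let ?body = "If (Times (Cell (entry (Reg 4) (Reg 5))) (odd_part (Div (Reg 13) (Cell (refP (Reg 4))))))
         (Seq (Store (Const 14) (Minus (Reg 14) (Cell (refP (Reg 4)))))
           (Store (Const 15) (Plus (Reg 15) (Const 1)))) Skip"
  have loop: "wp (For 4 (Reg 3) ?body) (8 * (z * (5 * K))) (\<lambda>s' w. agree {4, 14, 15} s s' \<and>
    s' 14 = s 13 - sum p X \<and> s' 15 = card X) (s(14 := s 13, 15 := 0)) w"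
  proof (rule wp_For[where Inv = Inv and n = m])
    show "Inv 0 (s(14 := s 13, 15 := 0, 4 := 0)) w" by (auto simp: Inv_def agree_def)
  next
    fix c s' w assume I: "Inv c s' w" and c: "s' 4 = c" "c < m"
    have s': "s' a = s a" if "a \<notin> {4, 14, 15}" for a using I that by (auto simp: Inv_def agree_def)
    have v: "s' 2 = n" "s' 5 = x" "s' 13 = s 13" "s' (addrP c) = p c"
      "s' (addrI (c * n + x)) = (if c \<in> E x then 1 else 0)"
      using coreD[OF core] x c by (auto simp: s')
    have guard: "aval (Times (Cell (entry (Reg 4) (Reg 5))) (odd_part (Div (Reg 13) (Cell (refP (Reg 4)))))) s' \<noteq> 0
      \<longleftrightarrow> c \<in> X"
      using c v by (auto simp: X_def selected_def odd_iff_mod_2_eq_one)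
    have "wp ?body (K + K + 1 + K + K) (\<lambda>s w. s 4 = c \<and> Inv (Suc c) (s(4 := Suc c)) w) s' w"
    proof (rule wp_If)
      assume "aval (Times (Cell (entry (Reg 4) (Reg 5))) (odd_part (Div (Reg 13) (Cell (refP (Reg 4)))))) s' \<noteq> 0"
      then have "c \<in> X" using guard by simp
      then have ins: "X \<inter> {..<Suc c} = insert c (X \<inter> {..<c})" by auto
      show "wp (Seq (Store (Const 14) (Minus (Reg 14) (Cell (refP (Reg 4)))))
           (Store (Const 15) (Plus (Reg 15) (Const 1)))) (K + K + 1) (\<lambda>s w. s 4 = c \<and> Inv (Suc c) (s(4 := Suc c)) w) s' w"
        using I c v by (intro wp_Seq wp_Store) (auto simp: Inv_def agree_def ins unit_cost_def)
    next
      assume "aval (Times (Cell (entry (Reg 4) (Reg 5))) (odd_part (Div (Reg 13) (Cell (refP (Reg 4)))))) s' = 0"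
      then have "c \<notin> X" using guard by simp
      then have "X \<inter> {..<Suc c} = X \<inter> {..<c}" by (auto simp: less_Suc_eq)
      then show "wp Skip K (\<lambda>s w. s 4 = c \<and> Inv (Suc c) (s(4 := Suc c)) w) s' w"
        using I c v by (intro wp_Skip) (auto simp: Inv_def agree_def)
    qed (simp add: unit_cost_def)
    then show "wp ?body (5 * K) (\<lambda>s w. s 4 = c \<and> Inv (Suc c) (s(4 := Suc c)) w) s' w"
      by (rule wp_mono) (auto simp: unit_cost_def)
  next
    fix c s' w assume I: "Inv c s' w"
    then show "aval (Reg 3) s' = m" using coreD[OF core] by (simp add: Inv_def agree_def)
  next
    fix s' w assume "Inv m s' w"
    then show "agree {4, 14, 15} s s' \<and> s' 14 = s 13 - sum p X \<and> s' 15 = card X"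
      by (simp add: Inv_def Xm)
  qed (use mz z1 in \<open>auto\<close>)
  have "wp split_mask (K + (K + 8 * (z * (5 * K)) + 1) + 1) (\<lambda>s' w. agree {4, 14, 15} s s' \<and>
    s' 14 = s 13 - sum p X \<and> s' 15 = card X) s w"
    unfolding split_mask_def
    by (intro wp_Seq wp_Store) (use loop in \<open>auto simp: unit_cost_def\<close>)
  moreover have "K + (K + 8 * (z * (5 * K)) + 1) + 1 \<le> 60 * (K * z)"
    using Kz mult.commute[of z "5 * K"] by linarith
  ultimately show ?thesis by (elim wp_mono) auto
qed

lemma wp_improve:
  assumes core: "core p u s" and x: "s 5 = x" "x < n" and d: "d \<le> 1" and A: "s 13 = A"
  defines "X \<equiv> selected p A \<inter> E x"
  shows "wp (improve d) (70 * (K * z)) (\<lambda>s' w. agree {4, 14, 15, addrT A} s s' \<and>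
    s' (addrT A) = max (s (addrT A)) (s (addrT (A - sum p X)) + card X - d)) s w"
proof -
  have "wp (improve d) (60 * (K * z) + (K + K + K) + 1) (\<lambda>s' w. agree {4, 14, 15, addrT A} s s' \<and>
    s' (addrT A) = max (s (addrT A)) (s (addrT (A - sum p X)) + card X - d)) s w"
    unfolding improve_def
  proof (rule wp_Seq, rule wp_mono[OF wp_split_mask[OF core x]])
    fix s' w
    assume "agree {4, 14, 15} s s' \<and>
      s' 14 = s 13 - sum p (selected p (s 13) \<inter> E x) \<and> s' 15 = card (selected p (s 13) \<inter> E x)"
    then have *: "agree {4, 14, 15} s s'" "s' 14 = A - sum p X" "s' 15 = card X"
      unfolding X_def A by auto
    have s': "s' a = s a" if "a \<notin> {4, 14, 15}" for a using *(1) that by (rule agreeD)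
    show "wp (If (Minus (candidate d) (Cell (refT (Reg 13)))) (Store (refT (Reg 13)) (candidate d)) Skip)
       (K + K + K) (\<lambda>s' w. agree {4, 14, 15, addrT A} s s' \<and>
    s' (addrT A) = max (s (addrT A)) (s (addrT (A - sum p X)) + card X - d)) s' w"
      using *(2,3) A d
      by (intro wp_If wp_Store wp_Skip)
        (auto simp: candidate_def s' agree_def unit_cost_def max_def)
  qed simp
  moreover have "60 * (K * z) + (K + K + K) + 1 \<le> 70 * (K * z)"
    using Kz by linarith
  ultimately show ?thesis by (elim wp_mono) auto
qed

section \<open>The dynamic program over subsets of U\<close>

lemma finite_selected: "core p u s \<Longrightarrow> finite (selected p A)"
  using selected_subset[of p A] coreD(6) by (meson finite_lessThan finite_subset)

lemma wp_stage1:
  assumes core0: "core p u s" and zero: "\<And>A. s (addrT A) = 0"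
  shows "wp stage1 (4480 * (2 ^ u * (K * z ^ 2))) (\<lambda>s' w. core p u s' \<and>
    (\<forall>A<2 ^ u. s' (addrT A) = excess E n (selected p A))) s w"
proof -
  let ?v = "\<lambda>A. excess E n (selected p A)"
  let ?sel = "selected p"
  have bw: "bit_weights p u" and fin: "finite (?sel A)" for A
    using coreD(7)[OF core0] finite_selected[OF core0] by auto
  define Inv where "Inv = (\<lambda>A s (w :: nat list). core p u s \<and>
    (\<forall>A'<A. s (addrT A') = ?v A') \<and> (\<forall>A'\<ge>A. s (addrT A') = 0))"
  \<comment> \<open>In round \<open>A\<close> the entry lies between the candidates seen so far and
    the true excess; after the last variable \<open>excess_cases\<close> closes the gap. The initial
    0 covers the case in which no variable helps.\<close>
  define Jnv where "Jnv = (\<lambda>A x s (w :: nat list). core p u s \<and> s 13 = A \<and>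
    (\<forall>A'<A. s (addrT A') = ?v A') \<and> (\<forall>A'>A. s (addrT A') = 0) \<and> s (addrT A) \<le> ?v A \<and>
    (\<forall>x'<x. ?sel A \<inter> E x' \<noteq> {} \<longrightarrow>
       excess E n (?sel A - E x') + card (?sel A \<inter> E x') - 1 \<le> s (addrT A)))"
  have inner: "wp (For 5 (Reg 2) (improve 1)) (8 * (z * (70 * (K * z))))
      (\<lambda>s w. s 13 = A \<and> Inv (Suc A) (s(13 := Suc A)) w) s w"
    if I: "Inv A s w" "s 13 = A" for A s w
  proof (rule wp_For[where Inv = "Jnv A" and n = n])
    show "Jnv A 0 (s(5 := 0)) w"
      using I by (auto simp: Inv_def Jnv_def core_upd)
  next
    fix x s w assume J: "Jnv A x s w" and x: "s 5 = x" "x < n"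
    have c: "core p u s" and A: "s 13 = A" using J by (auto simp: Jnv_def)
    let ?X = "?sel A \<inter> E x"
    let ?D = "A - sum p ?X"
    show "wp (improve 1) (70 * (K * z)) (\<lambda>s w. s 5 = x \<and> Jnv A (Suc x) (s(5 := Suc x)) w) s w"
    proof (rule wp_mono[OF wp_improve[OF c x le_refl A]])
      fix s' w
      assume *: "agree {4, 14, 15, addrT A} s s' \<and>
        s' (addrT A) = max (s (addrT A)) (s (addrT ?D) + card ?X - 1)"
      then have s': "s' a = s a" if "a \<notin> {4, 14, 15, addrT A}" for a using that by (auto simp: agree_def)
      have c': "core p u s'" by (rule core_agree[OF c conjunct1[OF *]]) auto
      \<comment> \<open>If \<open>x\<close> hits nothing in the subset, \<open>?D\<close> is
        \<open>A\<close> itself and the candidate does not exceed the current entry. Otherwise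
        \<open>?D < A\<close>, whose entry is final.\<close>
      have new: "s (addrT ?D) + card ?X - 1 \<le> ?v A"
        "?X \<noteq> {} \<Longrightarrow> s (addrT ?D) = excess E n (?sel A - E x)"
      proof -
        show "s (addrT ?D) = excess E n (?sel A - E x)" if "?X \<noteq> {}"
          using J selected_sum_pos[OF bw that] selected_diff(1)[OF bw, of A "E x"] by (simp add: Jnv_def)
        then show "s (addrT ?D) + card ?X - 1 \<le> ?v A"
          using J excess_insert_le[of x n "?sel A" E, OF x(2) fin[of A]]
          by (cases "?X = {}") (auto simp: Jnv_def)
      qed
      have "s' 5 = x" using x s' by simp
      moreover have "Jnv A (Suc x) (s'(5 := Suc x)) w"
        unfolding Jnv_def
      proof (intro conjI allI impI)
        show "core p u (s'(5 := Suc x))" using c' by (rule core_upd) simp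
        show "(s'(5 := Suc x)) (addrT A) \<le> ?v A" using * J new by (simp add: Jnv_def)
        fix x' assume x': "x' < Suc x" and ne: "?sel A \<inter> E x' \<noteq> {}"
        show "excess E n (?sel A - E x') + card (?sel A \<inter> E x') - 1 \<le> (s'(5 := Suc x)) (addrT A)"
        proof (cases "x' = x")
          case True
          with * new ne show ?thesis by simp
        next
          case False
          with x' have "x' < x" by simp
          with J ne have "excess E n (?sel A - E x') + card (?sel A \<inter> E x') - 1 \<le> s (addrT A)"
            by (simp add: Jnv_def)
          with * show ?thesis by simp
        qed
      qed (use J s' in \<open>auto simp: Jnv_def\<close>)
      ultimately show "s' 5 = x \<and> Jnv A (Suc x) (s'(5 := Suc x)) w" by blast
    qed simp
  next
    fix s w assume J: "Jnv A n s w"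
    have "?v A \<le> s (addrT A)"
    proof (cases "?v A = 0")
      case False
      with fin obtain x where "x < n" "?sel A \<inter> E x \<noteq> {}"
        "?v A + 1 \<le> excess E n (?sel A - E x) + card (?sel A \<inter> E x)"
        using excess_cases by blast
      with J show ?thesis unfolding Jnv_def by fastforce
    qed simp
    then have "s (addrT A) = ?v A" using J by (simp add: Jnv_def)
    then show "s 13 = A \<and> Inv (Suc A) (s(13 := Suc A)) w"
      using J by (auto simp: Jnv_def Inv_def core_upd less_Suc_eq)
  qed (use nz z1 Kz in \<open>auto simp: Jnv_def coreD\<close>)
  have "wp stage1 (8 * (2 ^ u * (8 * (z * (70 * (K * z)))))) (\<lambda>s' w. core p u s' \<and>
    (\<forall>A<2 ^ u. s' (addrT A) = ?v A)) s w"
    unfolding stage1_def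
  proof (rule wp_For[where Inv = Inv and n = "2 ^ u"])
    show "Inv 0 (s(13 := 0)) w" using core0 zero by (auto simp: Inv_def core_upd)
    have "1 * K \<le> z * (560 * (K * z))" using z1 Kz by (intro mult_mono) auto
    then show "K \<le> 8 * (z * (70 * (K * z)))" by simp
  qed (use inner in \<open>auto simp: Inv_def coreD\<close>)
  then show ?thesis by (elim wp_mono) (auto simp: power2_eq_square)
qed

definition outside :: "(nat \<Rightarrow> nat) \<Rightarrow> nat \<Rightarrow> nat set" where
  "outside p j = {c. c < j \<and> p c = 0}"

lemma outside_Suc: "outside p (Suc j) = (if p j = 0 then insert j (outside p j) else outside p j)"
  by (auto simp: outside_def less_Suc_eq)

lemma wp_stage2_inner:
  fixes p u j
  defines "v \<equiv> \<lambda>A. excess E n (selected p A \<union> outside p j)"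
    and "v' \<equiv> \<lambda>A. excess E n (selected p A \<union> outside p (Suc j))"
  assumes core0: "core p u s" and j: "s 16 = j" "j < m" "p j = 0" and A: "s 13 = A"
    and out: "\<And>x. x < n \<Longrightarrow> card (E x - {c. p c \<noteq> 0}) \<le> 1"
    and T: "\<And>A'. A' \<le> A \<Longrightarrow> s (addrT A') = v A'"
  shows "wp stage2_inner (8 * (z * (80 * (K * z)))) (\<lambda>s' w. core p u s' \<and>
    agree (insert (addrT A) {4, 5, 14, 15}) s s' \<and> s' (addrT A) = v' A) s w"
proof -
  let ?B = "selected p A" and ?U = "{c. p c \<noteq> 0}" and ?J = "outside p j"
  have bw: "bit_weights p u" and fin: "finite ?B" and finJ: "finite ?J"
    using coreD(7)[OF core0] finite_selected[OF core0] by (auto simp: outside_def)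
  have sets: "?B \<subseteq> ?U" "?J \<inter> ?U = {}" "j \<notin> ?J" "j \<notin> ?U"
    using selected_subset j(3) by (auto simp: outside_def)
  have v': "v' A = excess E n (insert j (?B \<union> ?J))"
    using j(3) by (simp add: v'_def outside_Suc)
  have vv': "v A \<le> v' A" unfolding v' v_def using fin finJ by (intro excess_mono) auto
  define Jnv where "Jnv = (\<lambda>x s' (w :: nat list). agree (insert (addrT A) {4, 5, 14, 15}) s s' \<and>
    v A \<le> s' (addrT A) \<and> s' (addrT A) \<le> v' A \<and>
    (\<forall>x'<x. j \<in> E x' \<longrightarrow> excess E n (?B - E x' \<union> ?J) + card (?B \<inter> E x') \<le> s' (addrT A)))"
  have core: "core p u s'" if "Jnv x s' w" for x s' w
    using that unfolding Jnv_def by (intro core_agree[OF core0, of _ s']) auto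
  show ?thesis
    unfolding stage2_inner_def
  proof (rule wp_For[where Inv = Jnv and n = n])
    show "Jnv 0 (s(5 := 0)) w" using T vv' by (auto simp: Jnv_def agree_def)
  next
    fix x s' w assume J: "Jnv x s' w" and x: "s' 5 = x" "x < n"
    note c = core[OF J]
    have s': "s' a = s a" if "a \<notin> insert (addrT A) {4, 5, 14, 15}" for a
      using J that by (auto simp: Jnv_def agree_def)
    have A': "s' 13 = A" "s' 16 = j" using A j s' by auto
    have guard: "aval (Cell (entry (Reg 16) (Reg 5))) s' \<noteq> 0 \<longleftrightarrow> j \<in> E x"
      using A' x j coreD[OF c] by simp
    let ?X = "?B \<inter> E x"
    let ?D = "A - sum p ?X"
    let ?Q = "\<lambda>s w. s 5 = x \<and> Jnv (Suc x) (s(5 := Suc x)) w"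
    have "wp (If (Cell (entry (Reg 16) (Reg 5))) (improve 0) Skip) (70 * (K * z) + K + K) ?Q s' w"
    proof (rule wp_If)
      assume "aval (Cell (entry (Reg 16) (Reg 5))) s' \<noteq> 0"
      then have jE: "j \<in> E x" using guard by simp
      then have Ex: "E x - ?U = {j}"
      proof -
        have "\<forall>a\<in>E x - ?U. \<forall>b\<in>E x - ?U. a = b"
          using out[OF x(2)] finite_E[of x] by (subst card_le_Suc0_iff_eq[symmetric]) auto
        with jE sets(4) show ?thesis by blast
      qed
      show "wp (improve 0) (70 * (K * z)) ?Q s' w"
      proof (rule wp_mono[OF wp_improve[OF c x _ A'(1)]])
        fix s2 w
        assume *: "agree {4, 14, 15, addrT A} s' s2 \<and>
          s2 (addrT A) = max (s' (addrT A)) (s' (addrT ?D) + card ?X - 0)"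
        then have s2: "s2 a = s' a" if "a \<notin> {4, 14, 15, addrT A}" for a
          using that by (auto simp: agree_def)
        have new: "excess E n (?B - E x \<union> ?J) + card ?X \<le> s2 (addrT A)" 
             "s2 (addrT A) \<le> v' A"
        proof -
          have ge: "excess E n (?B - E x \<union> ?J) + card ?X \<le> v' A"
            unfolding v' by (rule excess_free_ge) (fact x(2) Ex sets fin finJ)+
          \<comment> \<open>A nonempty hit leads to a smaller number, whose entry still belongs to
            the previous round.\<close>
          have D: "s' (addrT ?D) = excess E n (?B - E x \<union> ?J)" if "?X \<noteq> {}"
          proof -
            have "?D < A" by (rule selected_sum_pos[OF bw that])
            then have "s' (addrT ?D) = v ?D" using s' T by simp
            then show ?thesis unfolding v_def selected_diff(1)[OF bw] .
          qed
          \<comment> \<open>Here \<open>?D\<close> is \<open>A\<close>, whose entry may have been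
            raised in this round already. The candidate is then the entry itself, which is at least
            \<open>v A\<close>.\<close>
          have "?B - E x = ?B" if "?X = {}" using that by blast
          then show "excess E n (?B - E x \<union> ?J) + card ?X \<le> s2 (addrT A)"
            using * D J by (cases "?X = {}") (auto simp: Jnv_def v_def)
          show "s2 (addrT A) \<le> v' A"
            using * D J ge by (cases "?X = {}") (auto simp: Jnv_def)
        qed
        have "Jnv (Suc x) (s2(5 := Suc x)) w"
          unfolding Jnv_def
        proof (intro conjI allI impI)
          show "agree (insert (addrT A) {4, 5, 14, 15}) s (s2(5 := Suc x))"
            using s' s2 by (auto simp: agree_def)
          show "v A \<le> (s2(5 := Suc x)) (addrT A)" using J * by (simp add: Jnv_def le_max_iff_disj)
          show "(s2(5 := Suc x)) (addrT A) \<le> v' A" using new by simp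
          fix x' assume x': "x' < Suc x" "j \<in> E x'"
          show "excess E n (?B - E x' \<union> ?J) + card (?B \<inter> E x') \<le> (s2(5 := Suc x)) (addrT A)"
          proof (cases "x' = x")
            case True
            with new show ?thesis by simp
          next
            case False
            with x' J have "excess E n (?B - E x' \<union> ?J) + card (?B \<inter> E x') \<le> s' (addrT A)"
              by (simp add: Jnv_def)
            with * show ?thesis by simp
          qed
        qed
        with x s2 show "?Q s2 w" by simp
      qed simp_all
    next
      assume "aval (Cell (entry (Reg 16) (Reg 5))) s' = 0"
      then have "j \<notin> E x" using guard by simp
      then show "wp Skip K ?Q s' w"
        using J x by (intro wp_Skip) (auto simp: Jnv_def agree_def less_Suc_eq)
    qed (simp add: unit_cost_def)
    then show "wp (If (Cell (entry (Reg 16) (Reg 5))) (improve 0) Skip) (80 * (K * z)) ?Q s' w"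
      by (rule wp_mono) (use Kz in linarith)
  next
    fix s' w assume J: "Jnv n s' w"
    have "v' A \<le> s' (addrT A)"
    proof (cases "v A < v' A")
      case True
      then obtain x where "x < n" "j \<in> E x"
        "v' A \<le> excess E n (?B - E x \<union> ?J) + card (?B \<inter> E x)"
        using excess_free_cases[where E = E and n = n and U = ?U and B = ?B and J = ?J and j = j]
          out finite_E sets fin finJ unfolding v' v_def by blast
      with J show ?thesis unfolding Jnv_def by (meson le_trans)
    next
      case False
      with J show ?thesis by (simp add: Jnv_def)
    qed
    with J core[OF J] show "core p u s' \<and> agree (insert (addrT A) {4, 5, 14, 15}) s s' \<and> s' (addrT A) = v' A"
      by (simp add: Jnv_def)
  next
    fix x s' w assume "Jnv x s' w"
    then show "aval (Reg 2) s' = n" using coreD(2)[OF core] by simp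
  qed (use nz z1 Kz in auto)
qed

lemma wp_stage2:
  fixes p u
  assumes core0: "core p u s" 
    and out: "\<And>x. x < n \<Longrightarrow> card (E x - {c. p c \<noteq> 0}) \<le> 1"
    and T: "\<And>A. A < 2 ^ u \<Longrightarrow> s (addrT A) = excess E n (selected p A)"
  shows "wp stage2 (50000 * (2 ^ u * (K * z ^ 3))) (\<lambda>s' w. core p u s' \<and>
     s' (addrT (2 ^ u - 1)) = excess E n {..<m}) s w"
proof -
  let ?v = "\<lambda>j A. excess E n (selected p A \<union> outside p j)"
  define Inv where "Inv = (\<lambda>j s (w :: nat list). core p u s \<and> (\<forall>A<2 ^ u. s (addrT A) = ?v j A))"
  \<comment> \<open>After \<open>a\<close> steps of a descending pass, the \<open>a\<close> largest
    numbers carry the new values.\<close>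
  define Jnv where "Jnv = (\<lambda>j a s (w :: nat list). core p u s \<and> s 16 = j \<and>
     (\<forall>A<2 ^ u. s (addrT A) = (if A + a < 2 ^ u then ?v j A else ?v (Suc j) A)))"
  have pass: "wp stage2_pass (8 * (2 ^ u * (650 * (K * z ^ 2)))) (\<lambda>s w. s 16 = j \<and> Inv (Suc j) (s(16 := Suc j)) w) s w"
    if I: "Inv j s w" "s 16 = j" "j < m" "p j = 0" for j s w
    unfolding stage2_pass_def
  proof (rule wp_For[where Inv = "Jnv j" and n = "2 ^ u"])
    show "Jnv j 0 (s(17 := 0)) w" using I by (auto simp: Inv_def Jnv_def core_upd)
  next
    fix a s w assume J: "Jnv j a s w" and a: "s 17 = a" "a < 2 ^ u"
    have c: "core p u s" using J by (simp add: Jnv_def)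
    define A where "A = 2 ^ u - Suc a"
    have A: "A < 2 ^ u" "A + Suc a = 2 ^ u" using a by (auto simp: A_def)
    let ?s = "s(13 := A)"
    let ?Q = "\<lambda>s w. s 17 = a \<and> Jnv j (Suc a) (s(17 := Suc a)) w"
    have "wp stage2_inner (8 * (z * (80 * (K * z)))) ?Q ?s w"
    proof (rule wp_mono[OF wp_stage2_inner[where p = p and u = u and j = j and A = A]])
      show "core p u ?s" using c by (rule core_upd) simp
      show "?s 16 = j" using J by (simp add: Jnv_def)
      show "?s (addrT A') = ?v j A'" if "A' \<le> A" for A' using J that A by (simp add: Jnv_def)
      fix s' w assume *: "core p u s' \<and> agree (insert (addrT A) {4, 5, 14, 15}) ?s s' \<and> s' (addrT A) = ?v (Suc j) A"
      then have s': "s' b = ?s b" if "b \<notin> insert (addrT A) {4, 5, 14, 15}" for b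
        using that by (auto simp: agree_def)
      have "s' (addrT A') = (if A' + Suc a < 2 ^ u then ?v j A' else ?v (Suc j) A')" if "A' < 2 ^ u" for A'
      proof (cases "A' = A")
        case True
        with * A show ?thesis by simp
      next
        case False
        then have "s' (addrT A') = s (addrT A')" by (simp add: s')
        moreover have "A' + Suc a < 2 ^ u \<longleftrightarrow> A' + a < 2 ^ u" using False A by linarith
        ultimately show ?thesis using J that by (simp add: Jnv_def)
      qed
      then show "?Q s' w" using * J a s' by (auto simp: Jnv_def core_upd)
    qed (use I out in auto)
    moreover have "Suc a \<le> 2 ^ u" using a by simp
    ultimately have "wp (Seq (Store (Const 13) (Minus (Reg 12) (Plus (Reg 17) (Const 1)))) stage2_inner)
       (K + 8 * (z * (80 * (K * z))) + 1) ?Q s w"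
      using a coreD(4)[OF c] by (intro wp_Seq wp_Store) (auto simp: A_def unit_cost_def)
    then show "wp (Seq (Store (Const 13) (Minus (Reg 12) (Plus (Reg 17) (Const 1)))) stage2_inner)
       (650 * (K * z ^ 2)) ?Q s w"
    proof (rule wp_mono)
      have "K * 1 \<le> K * z ^ 2" using z1 by (intro mult_left_mono) auto
      moreover have "8 * (z * (80 * (K * z))) = 640 * (K * z ^ 2)" by (simp add: power2_eq_square)
      ultimately show "K + 8 * (z * (80 * (K * z))) + 1 \<le> 650 * (K * z ^ 2)" using Kz(3) by linarith
    qed
  next
    fix s w assume "Jnv j (2 ^ u) s w"
    then show "s 16 = j \<and> Inv (Suc j) (s(16 := Suc j)) w"
      by (auto simp: Jnv_def Inv_def core_upd)
  next
    have "K * 1 \<le> K * z ^ 2" using z1 by (intro mult_left_mono) auto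
    then show "K \<le> 650 * (K * z ^ 2)" by simp
  qed (auto simp: Jnv_def coreD)
  have "wp stage2 (8 * (z * (8 * (2 ^ u * (650 * (K * z ^ 2))) + K + K))) (\<lambda>s' w. core p u s' \<and>
     s' (addrT (2 ^ u - 1)) = excess E n {..<m}) s w"
    unfolding stage2_def
  proof (rule wp_For[where Inv = Inv and n = m])
    show "Inv 0 (s(16 := 0)) w" using core0 T by (auto simp: Inv_def core_upd outside_def)
  next
    fix j s w assume I: "Inv j s w" and j: "s 16 = j" "j < m"
    let ?Q = "\<lambda>s w. s 16 = j \<and> Inv (Suc j) (s(16 := Suc j)) w"
    have p: "s (addrP j) = p j" using I unfolding Inv_def by (blast dest: coreD(5))
    have "wp (If (Cell (refP (Reg 16))) Skip stage2_pass) (K + 8 * (2 ^ u * (650 * (K * z ^ 2))) + K) ?Q s w"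
    proof (rule wp_If)
      assume "aval (Cell (refP (Reg 16))) s \<noteq> 0"
      then show "wp Skip K ?Q s w" using I j p
        by (intro wp_Skip) (auto simp: Inv_def core_upd outside_Suc)
    next
      assume "aval (Cell (refP (Reg 16))) s = 0"
      then show "wp stage2_pass (8 * (2 ^ u * (650 * (K * z ^ 2)))) ?Q s w"
        using I j p by (intro pass) auto
    qed (simp add: unit_cost_def)
    then show "wp (If (Cell (refP (Reg 16))) Skip stage2_pass)
       (8 * (2 ^ u * (650 * (K * z ^ 2))) + K + K) ?Q s w"
      by (rule wp_mono) auto
  next
    fix s w assume I: "Inv m s w"
    have "selected p (2 ^ u - 1) = {c. p c \<noteq> 0}"
      by (rule bit_weights_full) (use coreD[OF core0] in simp)
    then have "selected p (2 ^ u - 1) \<union> outside p m = {..<m}"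
      using coreD(6)[OF core0] by (auto simp: outside_def)
    with I show "core p u s \<and> s (addrT (2 ^ u - 1)) = excess E n {..<m}"
      by (simp add: Inv_def)
  qed (use mz z1 in \<open>auto simp: Inv_def coreD\<close>)
  then show ?thesis
  proof (rule wp_mono)
    have "z * K * 1 \<le> 2 ^ u * (K * z ^ 3)"
    proof -
      have "K * z * 1 \<le> K * z * z ^ 2" using z1 by (intro mult_left_mono) auto
      also have "\<dots> \<le> 2 ^ u * (K * z ^ 3)" by (simp add: power3_eq_cube power2_eq_square)
      finally show ?thesis by (simp add: mult.commute)
    qed
    moreover have "8 * (z * (8 * (2 ^ u * (650 * (K * z ^ 2))) + K + K))
      = 41600 * (2 ^ u * (K * z ^ 3)) + 16 * (z * K)"
      by (simp add: power3_eq_cube power2_eq_square algebra_simps)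
    ultimately show "8 * (z * (8 * (2 ^ u * (650 * (K * z ^ 2))) + K + K))
      \<le> 50000 * (2 ^ u * (K * z ^ 3))" by linarith
  qed
qed

section \<open>The greedy phase\<close>

lemma uncovered_iff:
  assumes "core p u s" "s 4 = c" "s 5 = x" "c < m" "x < n"
  shows "aval uncovered s \<noteq> 0 \<longleftrightarrow> c \<in> E x \<and> p c = 0"
  using assms by (auto simp: uncovered_def coreD)

lemma weight_uncovered: "weight uncovered \<le> 10000"
  by (simp add: uncovered_def)

lemma wp_count_new:
  assumes core0: "core p u s" and x: "s 5 = x" "x < n"
  shows "wp count_new (30 * (K * z)) (\<lambda>s' w. agree {4, 9} s s' \<and>
    s' 9 = card (E x - {c. p c \<noteq> 0})) s w"
proof -
  let ?Y = "E x - {c. p c \<noteq> 0}"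
  let ?Q = "\<lambda>s' w. agree {4, 9} s s' \<and> s' 9 = card ?Y"
  define Inv where "Inv = (\<lambda>c s' (w :: nat list). agree {4, 9} s s' \<and> s' 9 = card (?Y \<inter> {..<c}))"
  have Ym: "?Y \<inter> {..<m} = ?Y" using E_sub[of x] by auto
  have loop: "wp (For 4 (Reg 3) (If uncovered (Store (Const 9) (Plus (Reg 9) (Const 1))) Skip))
      (8 * (z * (3 * K))) ?Q (s(9 := 0)) w"
  proof (rule wp_For[where Inv = Inv and n = m])
    show "Inv 0 (s(9 := 0, 4 := 0)) w" by (auto simp: Inv_def agree_def)
  next
    fix c s' w assume I: "Inv c s' w" and c: "s' 4 = c" "c < m"
    let ?R = "\<lambda>s w. s 4 = c \<and> Inv (Suc c) (s(4 := Suc c)) w"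
    have co: "core p u s'"
      by (rule core_agree[OF core0, of "{4, 9}"]) (use I in \<open>auto simp: Inv_def\<close>)
    have "s' 5 = x" using I x by (simp add: Inv_def agree_def)
    note guard = uncovered_iff[OF co c(1) this c(2) x(2)]
    have "wp (If uncovered (Store (Const 9) (Plus (Reg 9) (Const 1))) Skip) (K + K + K) ?R s' w"
    proof (rule wp_If)
      assume "aval uncovered s' \<noteq> 0"
      then have "?Y \<inter> {..<Suc c} = insert c (?Y \<inter> {..<c})" using guard by (auto simp: less_Suc_eq)
      then show "wp (Store (Const 9) (Plus (Reg 9) (Const 1))) K ?R s' w"
        using I c by (intro wp_Store) (auto simp: Inv_def agree_def unit_cost_def)
    next
      assume "aval uncovered s' = 0"
      then have "?Y \<inter> {..<Suc c} = ?Y \<inter> {..<c}" using guard by (auto simp: less_Suc_eq)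
      then show "wp Skip K ?R s' w"
        using I c by (intro wp_Skip) (auto simp: Inv_def agree_def)
    qed (use weight_uncovered in \<open>simp add: unit_cost_def\<close>)
    then show "wp (If uncovered (Store (Const 9) (Plus (Reg 9) (Const 1))) Skip) (3 * K) ?R s' w"
      by (rule wp_mono) auto
  next
    fix c s' w assume "Inv c s' w"
    then show "aval (Reg 3) s' = m" using core0 by (simp add: Inv_def agree_def coreD)
  qed (use mz z1 Ym in \<open>auto simp: Inv_def\<close>)
  have "wp count_new (K + 8 * (z * (3 * K)) + 1) ?Q s w"
    unfolding count_new_def
    by (intro wp_Seq wp_Store) (use loop in \<open>auto simp: unit_cost_def\<close>)
  moreover have "K + 8 * (z * (3 * K)) + 1 \<le> 30 * (K * z)"
    using Kz mult.commute[of z "3 * K"] by linarith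
  ultimately show ?thesis by (elim wp_mono) auto
qed

lemma core_add:
  assumes "core p u s" "c < m" "p c = 0"
  shows "core (p(c := 2 ^ u)) (Suc u) (s(addrP c := 2 ^ u, 12 := 2 ^ u + 2 ^ u, 10 := v))"
  using assms bit_weights_add[OF coreD(7)[OF assms(1)] assms(3)]
  by (auto simp: core_def)

text \<open>Weights may be written during the scan, since the test for a clause looks at no weight
  but its own.\<close>

lemma wp_add_new:
  assumes core0: "core p u s" and x: "s 5 = x" "x < n" and u: "s 10 = u"
    and T: "\<And>A. s (addrT A) = 0"
  shows "wp add_new (60 * (K * z)) (\<lambda>s' w. \<exists>p' u'. core p' u' s' \<and> s' 10 = u' \<and> s' 11 = s 11 + 1 \<and>
    s' 5 = x \<and> (\<forall>A. s' (addrT A) = 0) \<and> {c. p' c \<noteq> 0} = {c. p c \<noteq> 0} \<union> E x) s w"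
    (is "wp _ _ ?Q s w")
proof -
  let ?U = "{c. p c \<noteq> 0}"
  define Inv where "Inv = (\<lambda>c s' (w :: nat list). \<exists>p' u'. core p' u' s' \<and> s' 10 = u' \<and>
    s' 11 = s 11 + 1 \<and> s' 5 = x \<and> (\<forall>A. s' (addrT A) = 0) \<and> {c. p' c \<noteq> 0} = ?U \<union> (E x \<inter> {..<c}))"
  have Em: "E x \<inter> {..<m} = E x" using E_sub[of x] by auto
  let ?ins = "Seq (Store (refP (Reg 4)) (Reg 12)) (Seq (Store (Const 12) (Plus (Reg 12) (Reg 12)))
         (Store (Const 10) (Plus (Reg 10) (Const 1))))"
  have loop: "wp (For 4 (Reg 3) (If uncovered ?ins Skip)) (8 * (z * (6 * K))) ?Q (s(11 := s 11 + 1)) w"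
  proof (rule wp_For[where Inv = Inv and n = m])
    have "core p u (s(11 := s 11 + 1, 4 := 0))" by (intro core_upd core0) simp_all
    then show "Inv 0 (s(11 := s 11 + 1, 4 := 0)) w"
      unfolding Inv_def using u x T by (intro exI[of _ p] exI[of _ u]) simp
  next
    fix c s' w assume "Inv c s' w" and c: "s' 4 = c" "c < m"
    then obtain p' u' where I: "core p' u' s'" "s' 10 = u'" "s' 11 = s 11 + 1" "s' 5 = x"
      "\<And>A. s' (addrT A) = 0" "{c. p' c \<noteq> 0} = ?U \<union> (E x \<inter> {..<c})"
      unfolding Inv_def by blast
    let ?R = "\<lambda>s w. s 4 = c \<and> Inv (Suc c) (s(4 := Suc c)) w"
    note guard = uncovered_iff[OF I(1) c(1) I(4) c(2) x(2)]
    have "wp (If uncovered ?ins Skip) (K + (K + K + 1) + 1 + K + K) ?R s' w"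
    proof (rule wp_If)
      assume "aval uncovered s' \<noteq> 0"
      then have g: "c \<in> E x" "p' c = 0" using guard by auto
      have "core (p'(c := 2 ^ u')) (Suc u')
         (s'(addrP c := 2 ^ u', 12 := 2 ^ u' + 2 ^ u', 10 := Suc u', 4 := Suc c))"
        by (intro core_upd core_add I(1) c g) simp
      moreover have "{c'. (p'(c := 2 ^ u')) c' \<noteq> 0} = insert c {c. p' c \<noteq> 0}" by auto
      then have "{c'. (p'(c := 2 ^ u')) c' \<noteq> 0} = ?U \<union> (E x \<inter> {..<Suc c})"
        unfolding I(6) using g by (auto simp: less_Suc_eq)
      ultimately have "Inv (Suc c) (s'(addrP c := 2 ^ u', 12 := 2 ^ u' + 2 ^ u', 10 := Suc u', 4 := Suc c)) w"
        unfolding Inv_def using I(3-5) by (intro exI[of _ "p'(c := 2 ^ u')"] exI[of _ "Suc u'"]) simp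
      then show "wp ?ins (K + (K + K + 1) + 1) ?R s' w"
        using c I(2) coreD(4)[OF I(1)] by (intro wp_Seq wp_Store) (simp_all add: unit_cost_def)
    next
      assume "aval uncovered s' = 0"
      then have "c \<in> E x \<Longrightarrow> c \<in> {c. p' c \<noteq> 0}" using guard by simp
      then have "c \<in> E x \<Longrightarrow> c \<in> ?U" unfolding I(6) by auto
      then have "?U \<union> (E x \<inter> {..<Suc c}) = {c. p' c \<noteq> 0}"
        unfolding I(6) by (auto simp: less_Suc_eq)
      moreover have "core p' u' (s'(4 := Suc c))" using I(1) by (rule core_upd) simp
      ultimately have "Inv (Suc c) (s'(4 := Suc c)) w"
        unfolding Inv_def using I by (intro exI[of _ p'] exI[of _ u']) simp
      then show "wp Skip K ?R s' w"
        using c by (intro wp_Skip) simp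
    qed (use weight_uncovered in \<open>simp add: unit_cost_def\<close>)
    then show "wp (If uncovered ?ins Skip) (6 * K) ?R s' w"
      by (rule wp_mono) (auto simp: unit_cost_def)
  next
    fix c s' w assume "Inv c s' w"
    then show "aval (Reg 3) s' = m" by (auto simp: Inv_def coreD)
  next
    fix s' w assume "Inv m s' w"
    then show "?Q s' w" unfolding Inv_def Em .
  qed (use mz z1 in auto)
  have "wp add_new (K + 8 * (z * (6 * K)) + 1) ?Q s w"
    unfolding add_new_def
    by (intro wp_Seq wp_Store) (use loop in \<open>auto simp: unit_cost_def\<close>)
  moreover have "K + 8 * (z * (6 * K)) + 1 \<le> 60 * (K * z)"
    using Kz mult.commute[of z "6 * K"] by linarith
  ultimately show ?thesis by (elim wp_mono) auto
qed

text \<open>\<open>S\<close> certifies a positive answer if \<open>u\<close> is large enough;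
  \<open>2 * t \<le> u\<close> bounds \<open>u\<close> if it is not; the last conjunct is the
  premise of the second stage.\<close>

definition greedy_state :: "nat \<Rightarrow> (nat \<Rightarrow> nat) \<Rightarrow> nat \<Rightarrow> nat \<Rightarrow> memory \<Rightarrow> bool" where
  "greedy_state x p u t s \<longleftrightarrow> core p u s \<and> s 10 = u \<and> s 11 = t \<and> (\<forall>A. s (addrT A) = 0) \<and> 2 * t \<le> u \<and>
     (\<exists>S\<subseteq>{..<x}. card S = t \<and> \<Union>(E ` S) = {c. p c \<noteq> 0}) \<and>
     (\<forall>x'<x. card (E x' - {c. p c \<noteq> 0}) \<le> 1)"

lemma wp_greedy:
  assumes core0: "core (\<lambda>_. 0) 0 (s(12 := 1))" and z: "s 10 = 0" "s 11 = 0" "\<And>A. s (addrT A) = 0"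
  shows "wp greedy (1000 * (K * z ^ 2)) (\<lambda>s w. \<exists>p u t. greedy_state n p u t s) s w"
proof -
  define Inv where "Inv = (\<lambda>x s (w :: nat list). \<exists>p u t. greedy_state x p u t s)"
  let ?body = "Seq count_new (If (Minus (Reg 9) (Const 1)) add_new Skip)"
  have loop: "wp (For 5 (Reg 2) ?body) (8 * (z * (100 * (K * z)))) (Inv n) (s(12 := 1)) w"
  proof (rule wp_For[where Inv = Inv and n = n])
    have "core (\<lambda>_. 0) 0 (s(12 := 1, 5 := 0))" using core0 by (rule core_upd) simp
    then show "Inv 0 (s(12 := 1, 5 := 0)) w"
      unfolding Inv_def greedy_state_def using z
      by (intro exI[of _ "\<lambda>_. 0"] exI[of _ 0]) simp
  next
    fix x s w assume "Inv x s w" and x: "s 5 = x" "x < n"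
    then obtain p u t S where I: "core p u s" "s 10 = u" "s 11 = t" "\<And>A. s (addrT A) = 0" "2 * t \<le> u"
      "S \<subseteq> {..<x}" "card S = t" "\<Union>(E ` S) = {c. p c \<noteq> 0}"
      "\<And>x'. x' < x \<Longrightarrow> card (E x' - {c. p c \<noteq> 0}) \<le> 1"
      unfolding Inv_def greedy_state_def by blast
    let ?R = "\<lambda>s w. s 5 = x \<and> Inv (Suc x) (s(5 := Suc x)) w"
    let ?U = "{c. p c \<noteq> 0}"
    have finU: "finite ?U" using coreD(6)[OF I(1)] finite_subset by blast
    have "wp ?body (30 * (K * z) + (60 * (K * z) + K + K) + 1) ?R s w"
    proof (rule wp_Seq, rule wp_mono[OF wp_count_new[OF I(1) x]])
      fix s' w assume *: "agree {4, 9} s s' \<and> s' 9 = card (E x - ?U)"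
      then have s': "s' a = s a" if "a \<notin> {4, 9}" for a using that by (auto simp: agree_def)
      have c: "core p u s'" by (rule core_agree[OF I(1) conjunct1[OF *]]) auto
      show "wp (If (Minus (Reg 9) (Const 1)) add_new Skip) (60 * (K * z) + K + K) ?R s' w"
      proof (rule wp_If)
        assume "aval (Minus (Reg 9) (Const 1)) s' \<noteq> 0"
        then have new: "card (E x - ?U) \<ge> 2" using * by simp
        show "wp add_new (60 * (K * z)) ?R s' w"
        proof (rule wp_mono[OF wp_add_new[OF c _ x(2)]])
          fix s2 w assume "\<exists>p' u'. core p' u' s2 \<and> s2 10 = u' \<and> s2 11 = s' 11 + 1 \<and>
            s2 5 = x \<and> (\<forall>A. s2 (addrT A) = 0) \<and> {c. p' c \<noteq> 0} = ?U \<union> E x"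
          then obtain p' u' where s2: "core p' u' s2" "s2 10 = u'" "s2 11 = t + 1" "s2 5 = x"
            "\<And>A. s2 (addrT A) = 0" "{c. p' c \<noteq> 0} = ?U \<union> E x" using I(3) s' by auto
          have "u' = card (?U \<union> E x)" using bit_weights_card coreD(7)[OF s2(1)] s2(6) by metis
          also have "?U \<union> E x = ?U \<union> (E x - ?U)" by blast
          also have "card \<dots> = card ?U + card (E x - ?U)"
            using finU finite_E by (intro card_Un_disjoint) auto
          also have "card ?U = u" by (rule bit_weights_card[OF coreD(7)[OF I(1)]])
          finally have "u + 2 \<le> u'" using add_left_mono[OF new, of u] by simp
          then have u': "2 * (t + 1) \<le> u'" using I(5) by simp
          have "finite S" "x \<notin> S" using I(6) finite_subset by auto
          then have S: "insert x S \<subseteq> {..<Suc x}" "card (insert x S) = t + 1"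
            "\<Union>(E ` insert x S) = {c. p' c \<noteq> 0}" using I(6-8) s2(6) by auto
          have small: "card (E x' - {c. p' c \<noteq> 0}) \<le> 1" if "x' < Suc x" for x'
          proof (cases "x' = x")
            case True
            then have "E x' - {c. p' c \<noteq> 0} = {}" unfolding s2(6) by blast
            then show ?thesis by (simp only: card.empty)
          next
            case False
            have "card (E x' - {c. p' c \<noteq> 0}) \<le> card (E x' - ?U)"
              unfolding s2(6) using finite_E by (intro card_mono) auto
            with I(9)[of x'] that False show ?thesis by simp
          qed
          have "core p' u' (s2(5 := Suc x))" using s2(1) by (rule core_upd) simp
          then have "greedy_state (Suc x) p' u' (t + 1) (s2(5 := Suc x))"
            unfolding greedy_state_def using s2 u' S small
            by (intro conjI exI[of _ "insert x S"]) auto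
          then show "?R s2 w" using s2(4) unfolding Inv_def by blast
        qed (use s' x I in auto)
      next
        assume "aval (Minus (Reg 9) (Const 1)) s' = 0"
        then have "card (E x - ?U) \<le> 1" using * by simp
        then have "card (E x' - ?U) \<le> 1" if "x' < Suc x" for x'
          using I(9) that by (cases "x' = x") auto
        moreover have "core p u (s'(5 := Suc x))" using c by (rule core_upd) simp
        ultimately have "greedy_state (Suc x) p u t (s'(5 := Suc x))"
          unfolding greedy_state_def using I s'
          by (intro conjI exI[of _ S]) auto
        then have "Inv (Suc x) (s'(5 := Suc x)) w" unfolding Inv_def by blast
        then show "wp Skip K ?R s' w" using s' x by (intro wp_Skip) simp
      qed (simp add: unit_cost_def)
    qed simp
    then show "wp ?body (100 * (K * z)) ?R s w" by (rule wp_mono) (use Kz in linarith)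
  next
    fix x s w assume "Inv x s w"
    then show "aval (Reg 2) s = n" by (auto simp: Inv_def greedy_state_def coreD)
  qed (use nz z1 Kz in auto)
  have "wp greedy (K + 8 * (z * (100 * (K * z))) + 1) (Inv n) s w"
    unfolding greedy_def
    by (intro wp_Seq wp_Store) (use loop in \<open>auto simp: unit_cost_def\<close>)
  moreover have "K + 8 * (z * (100 * (K * z))) + 1 \<le> 1000 * (K * z ^ 2)"
  proof -
    have "K * 1 \<le> K * z ^ 2" using z1 by (intro mult_left_mono) auto
    moreover have "8 * (z * (100 * (K * z))) = 800 * (K * z ^ 2)" by (simp add: power2_eq_square)
    ultimately show ?thesis using Kz(3) by linarith
  qed
  ultimately show ?thesis by (elim wp_mono) (auto simp: Inv_def)
qed

lemma wp_decide:
  assumes "greedy_state n p u t s"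
  shows "wp decide (60000 * (4 ^ k * (K * z ^ 3)))
    (\<lambda>s w. s 0 = (if k \<le> excess E n {..<m} then 1 else 0)) s w"
    (is "wp _ _ ?Q s w")
proof -
  from assms obtain S where g: "core p u s" "s 10 = u" "s 11 = t" "\<And>A. s (addrT A) = 0" "2 * t \<le> u"
    "S \<subseteq> {..<n}" "card S = t" "\<Union>(E ` S) = {c. p c \<noteq> 0}"
    "\<And>x. x < n \<Longrightarrow> card (E x - {c. p c \<noteq> 0}) \<le> 1"
    unfolding greedy_state_def by blast
  have "1 * (K * 1) \<le> 4 ^ k * (K * z ^ 3)" using z1 by (intro mult_mono) auto
  then have big: "K \<le> 4 ^ k * (K * z ^ 3)" by simp
  show ?thesis
  proof (cases "k + t \<le> u")
    case True
    have "\<Union>(E ` S) \<inter> {..<m} = {c. p c \<noteq> 0}" using g(8) coreD(6)[OF g(1)] by auto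
    then have "k \<le> excess E n {..<m}"
      using excess_ge[OF g(6), of E "{..<m}"] bit_weights_card[OF coreD(7)[OF g(1)]] g(7) True by simp
    then have "wp decide (K + 0 + K) ?Q s w"
      unfolding decide_def using g True coreD(1)[OF g(1)]
      by (intro wp_If wp_Store) (auto simp: unit_cost_def)
    then show ?thesis by (rule wp_mono) (use big in linarith)
  next
    case False
    let ?rest = "Seq stage1 (Seq stage2
         (Store (Const 0) (Minus (Const 1) (Minus (Reg 1) (Cell (refT (Minus (Reg 12) (Const 1))))))))"
    have "wp ?rest (4480 * (2 ^ u * (K * z ^ 2)) + (50000 * (2 ^ u * (K * z ^ 3)) + K + 1) + 1) ?Q s w"
    proof (rule wp_Seq, rule wp_mono[OF wp_stage1[OF g(1,4)] le_refl])
      fix s1 w assume s1: "core p u s1 \<and> (\<forall>A<2 ^ u. s1 (addrT A) = excess E n (selected p A))"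
      show "wp (Seq stage2 (Store (Const 0) (Minus (Const 1) (Minus (Reg 1) (Cell (refT (Minus (Reg 12) (Const 1))))))))
        (50000 * (2 ^ u * (K * z ^ 3)) + K + 1) ?Q s1 w"
      proof (rule wp_Seq, rule wp_mono[OF wp_stage2[of p u] le_refl])
        fix s2 w assume s2: "core p u s2 \<and> s2 (addrT (2 ^ u - 1)) = excess E n {..<m}"
        then have "s2 1 = k" "s2 12 = 2 ^ u" by (auto dest: coreD)
        with s2 show "wp (Store (Const 0) (Minus (Const 1) (Minus (Reg 1) (Cell (refT (Minus (Reg 12) (Const 1)))))))
           K ?Q s2 w"
          by (intro wp_Store) (auto simp: unit_cost_def)
      qed (use s1 g in auto)
    qed
    then have "wp decide (0 + (4480 * (2 ^ u * (K * z ^ 2)) + (50000 * (2 ^ u * (K * z ^ 3)) + K + 1) + 1) + K) ?Q s w"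
      unfolding decide_def using g False coreD(1)[OF g(1)]
      by (intro wp_If) (auto simp: unit_cost_def)
    then show ?thesis
    proof (rule wp_mono)
      \<comment> \<open>From \<open>u < k + t\<close> and \<open>2 * t \<le> u\<close> one gets
        \<open>t < k\<close>, hence \<open>u < 2 * k\<close>. This is the source of the factor
        \<open>4 ^ k\<close>.\<close>
      have "u \<le> 2 * k" using False g(5) by linarith
      then have "(2 :: nat) ^ u \<le> 2 ^ (2 * k)" by (intro power_increasing) auto
      then have p4: "(2 :: nat) ^ u \<le> 4 ^ k" by (simp add: power_mult)
      have "2 ^ u * (K * z ^ 3) \<le> 4 ^ k * (K * z ^ 3)" by (intro mult_right_mono p4) simp
      moreover have "2 ^ u * (K * z ^ 2) \<le> 4 ^ k * (K * z ^ 3)"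
        using z1 by (intro mult_mono p4 power_increasing) auto
      ultimately show "0 + (4480 * (2 ^ u * (K * z ^ 2)) + (50000 * (2 ^ u * (K * z ^ 3)) + K + 1) + 1) + K
        \<le> 60000 * (4 ^ k * (K * z ^ 3))" using big Kz(3) by linarith
    qed
  qed
qed

lemma wp_greedy_decide:
  assumes core0: "core (\<lambda>_. 0) 0 (s(12 := 1))" and z: "s 10 = 0" "s 11 = 0" "\<And>A. s (addrT A) = 0"
  shows "wp (Seq greedy decide) (62000 * (4 ^ k * (K * z ^ 3)))
    (\<lambda>s w. s 0 = (if k \<le> excess E n {..<m} then 1 else 0)) s w"
proof -
  have "wp (Seq greedy decide) (1000 * (K * z ^ 2) + 60000 * (4 ^ k * (K * z ^ 3)) + 1)
    (\<lambda>s w. s 0 = (if k \<le> excess E n {..<m} then 1 else 0)) s w"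
    using wp_decide by (intro wp_Seq wp_mono[OF wp_greedy[OF assms]]) auto
  then show ?thesis
  proof (rule wp_mono)
    have "1 * (K * z ^ 2) \<le> 4 ^ k * (K * z ^ 3)" "1 * (1 * 1) \<le> 4 ^ k * (K * z ^ 3)"
      using z1 Kz(3) by (intro mult_mono power_increasing; simp)+
    then show "1000 * (K * z ^ 2) + 60000 * (4 ^ k * (K * z ^ 3)) + 1 \<le> 62000 * (4 ^ k * (K * z ^ 3))"
      by linarith
  qed
qed

end

section \<open>Reading the input\<close>

definition row_entries :: "nat \<Rightarrow> nat \<Rightarrow> nat list \<Rightarrow> nat set" where
  "row_entries n c r = {c * n + x | x. 2 * x + 1 \<in> set r}"

definition entries :: "nat \<Rightarrow> nat list list \<Rightarrow> nat \<Rightarrow> nat set" where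
  "entries n rows c = (\<Union>c'<c. row_entries n c' (rows ! c'))"

text \<open>Division with remainder recovers row and column from a row-major index, because the
  bound on literal codes keeps every column below \<open>n\<close>.\<close>

lemma entries_iff:
  assumes "\<And>r l. r \<in> set rows \<Longrightarrow> l \<in> set r \<Longrightarrow> l < 2 * n" "c < length rows" "x < n"
  shows "c * n + x \<in> entries n rows (length rows) \<longleftrightarrow> c \<in> hits rows x"
proof
  assume "c * n + x \<in> entries n rows (length rows)"
  then obtain c' x' where *: "c' < length rows" "2 * x' + 1 \<in> set (rows ! c')" "c * n + x = c' * n + x'"
    by (auto simp: entries_def row_entries_def)
  have "x' < n" using assms(1)[OF nth_mem[OF *(1)] *(2)] by simp
  have "c = (c * n + x) div n" "x = (c * n + x) mod n" using assms(3) by simp_all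
  moreover have "c' = (c' * n + x') div n" "x' = (c' * n + x') mod n" using \<open>x' < n\<close> by simp_all
  ultimately have "c = c'" "x = x'" using *(3) by metis+
  with * assms(2) show "c \<in> hits rows x" by (simp add: hits_def)
qed (use assms(2) in \<open>auto simp: entries_def row_entries_def hits_def\<close>)

definition loaded :: "nat \<Rightarrow> nat \<Rightarrow> nat \<Rightarrow> nat set \<Rightarrow> memory \<Rightarrow> bool" where
  "loaded k n m X s \<longleftrightarrow> s 1 = k \<and> s 2 = n \<and> s 3 = m \<and> s 10 = 0 \<and> s 11 = 0 \<and>
     (\<forall>i. s (addrI i) = (if i \<in> X then 1 else 0)) \<and> (\<forall>i. s (addrP i) = 0) \<and> (\<forall>i. s (addrT i) = 0)"

lemma loaded_upd [simp]:
  "i \<in> {4, 6, 7, 8} \<Longrightarrow> loaded k n m X (s(i := v)) = loaded k n m X s"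
  by (auto simp: loaded_def)

lemma wp_read_input:
  assumes rows: "\<And>r. r \<in> set rows \<Longrightarrow> length r \<le> 2 * z"
    and z: "length rows \<le> z" "1 \<le> z"
  shows "wp read_input (2000 * (K * z ^ 2))
    (\<lambda>s w. loaded (a - n) n (length rows) (entries n rows (length rows)) s)
    (\<lambda>_. 0) ([a, n, length rows] @ concat (map (\<lambda>r. length r # r) rows))"
    (is "wp _ _ ?Q _ _")
proof -
  let ?m = "length rows" and ?k = "a - n"
  let ?X = "entries n rows"
  define rest where "rest = (\<lambda>c. concat (map (\<lambda>r. length r # r) (drop c rows)))"
  have rest_Suc: "rest c = length (rows ! c) # rows ! c @ rest (Suc c)" if "c < ?m" for c
    unfolding rest_def using that by (simp flip: Cons_nth_drop_Suc)
  define Inv where "Inv = (\<lambda>c s w. loaded ?k n ?m (?X c) s \<and> w = rest c)"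
  define Jnv where "Jnv = (\<lambda>c l s w. loaded ?k n ?m (?X c \<union> row_entries n c (take l (rows ! c))) s \<and>
    s 4 = c \<and> s 6 = length (rows ! c) \<and> w = drop l (rows ! c) @ rest (Suc c))"
  let ?set = "If (odd_part (Reg 8)) (Store (entry (Reg 4) (Div (Reg 8) (Const 2))) (Const 1)) Skip"
  let ?lits = "For 7 (Reg 6) (Seq (Read (Const 8)) ?set)"
  let ?clause = "Seq (Read (Const 6)) ?lits"
  have lits: "wp ?lits (8 * (2 * z * (5 * K))) (\<lambda>s w. s 4 = c \<and> Inv (Suc c) (s(4 := Suc c)) w) s (rows ! c @ rest (Suc c))"
    if I: "loaded ?k n ?m (?X c) s" "s 4 = c" "s 6 = length (rows ! c)" and c: "c < ?m" for c s
  proof (rule wp_For[where Inv = "Jnv c" and n = "length (rows ! c)"])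
    show "Jnv c 0 (s(7 := 0)) (rows ! c @ rest (Suc c))"
      using I by (simp add: Jnv_def row_entries_def)
  next
    fix l s w assume J: "Jnv c l s w" and l: "s 7 = l" "l < length (rows ! c)"
    let ?R = "\<lambda>s w. s 7 = l \<and> Jnv c (Suc l) (s(7 := Suc l)) w"
    let ?lit = "rows ! c ! l"
    let ?s = "s(8 := ?lit)" and ?w = "drop (Suc l) (rows ! c) @ rest (Suc c)"
    have w: "w = ?lit # ?w" using J l(2) by (simp add: Jnv_def Cons_nth_drop_Suc)
    have ld: "loaded ?k n ?m (?X c \<union> row_entries n c (take l (rows ! c))) ?s"
      and r: "s 4 = c" "s 6 = length (rows ! c)" "s 2 = n" using J by (auto simp: Jnv_def loaded_def)
    have take: "take (Suc l) (rows ! c) = take l (rows ! c) @ [?lit]"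
      using l(2) by (rule take_Suc_conv_app_nth)
    have "wp ?set (K + K + K) ?R ?s ?w"
    proof (rule wp_If)
      assume "aval (odd_part (Reg 8)) ?s \<noteq> 0"
      then have odd: "?lit = 2 * (?lit div 2) + 1" by simp presburger
      have "row_entries n c (take (Suc l) (rows ! c))
          = insert (c * n + ?lit div 2) (row_entries n c (take l (rows ! c)))"
      proof -
        have "2 * x + 1 = ?lit \<longleftrightarrow> x = ?lit div 2" for x using odd by linarith
        then show ?thesis unfolding row_entries_def take by auto
      qed
      then have "Jnv c (Suc l) (?s(addrI (c * n + ?lit div 2) := 1, 7 := Suc l)) ?w"
        unfolding Jnv_def using ld r by (simp add: loaded_def)
      then show "wp (Store (entry (Reg 4) (Div (Reg 8) (Const 2))) (Const 1)) K ?R ?s ?w"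
        using r l by (intro wp_Store) (simp_all add: unit_cost_def)
    next
      assume "aval (odd_part (Reg 8)) ?s = 0"
      then have even: "?lit \<noteq> 2 * x + 1" for x by simp presburger
      have "row_entries n c (take (Suc l) (rows ! c)) = row_entries n c (take l (rows ! c))"
        unfolding row_entries_def take using even by (auto simp: eq_commute)
      then have "Jnv c (Suc l) (?s(7 := Suc l)) ?w"
        unfolding Jnv_def using ld r by simp
      then show "wp Skip K ?R ?s ?w"
        using l by (intro wp_Skip) simp
    qed (simp add: unit_cost_def)
    then have "wp (Seq (Read (Const 8)) ?set) (K + (K + K + K) + 1) ?R s w"
      unfolding w by (intro wp_Seq wp_Read) (auto simp: unit_cost_def)
    then show "wp (Seq (Read (Const 8)) ?set) (5 * K) ?R s w"
      by (rule wp_mono) (auto simp: unit_cost_def)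
  next
    fix s w assume J: "Jnv c (length (rows ! c)) s w"
    have "?X (Suc c) = ?X c \<union> row_entries n c (rows ! c)"
      by (auto simp: entries_def less_Suc_eq)
    with J show "s 4 = c \<and> Inv (Suc c) (s(4 := Suc c)) w"
      by (simp add: Jnv_def Inv_def)
  next
    show "length (rows ! c) \<le> 2 * z" using rows[OF nth_mem[OF c]] .
  qed (use z in \<open>auto simp: Jnv_def\<close>)
  have K1: "1 \<le> K" by (simp add: unit_cost_def)
  have Kz: "K * 1 \<le> K * z" using z by (intro mult_left_mono) auto
  have loop: "wp (For 4 (Reg 3) ?clause) (8 * (z * (100 * (K * z)))) ?Q s (rest 0)"
    if ld: "loaded ?k n ?m {} s" for s
  proof (rule wp_For[where Inv = Inv and n = ?m])
    show "Inv 0 (s(4 := 0)) (rest 0)" using ld by (simp add: Inv_def entries_def)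
  next
    fix c s w assume I: "Inv c s w" and c: "s 4 = c" "c < ?m"
    have "wp ?clause (K + 8 * (2 * z * (5 * K)) + 1) (\<lambda>s w. s 4 = c \<and> Inv (Suc c) (s(4 := Suc c)) w) s w"
    proof (rule wp_Seq)
      have w: "w = length (rows ! c) # rows ! c @ rest (Suc c)" using I c(2) rest_Suc by (simp add: Inv_def)
      show "wp (Read (Const 6)) K (wp ?lits (8 * (2 * z * (5 * K))) (\<lambda>s w. s 4 = c \<and> Inv (Suc c) (s(4 := Suc c)) w)) s w"
        unfolding w
      proof (rule wp_Read)
        show "wp ?lits (8 * (2 * z * (5 * K))) (\<lambda>s w. s 4 = c \<and> Inv (Suc c) (s(4 := Suc c)) w)
          (s(aval (Const 6) s := length (rows ! c))) (rows ! c @ rest (Suc c))"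
          using I c by (intro lits) (simp_all add: Inv_def)
      qed (simp add: unit_cost_def)
    qed
    moreover have "K + 8 * (2 * z * (5 * K)) + 1 \<le> 100 * (K * z)"
    proof -
      have "8 * (2 * z * (5 * K)) = 80 * (K * z)" by simp
      then show ?thesis using Kz K1 by linarith
    qed
    ultimately show "wp ?clause (100 * (K * z)) (\<lambda>s w. s 4 = c \<and> Inv (Suc c) (s(4 := Suc c)) w) s w"
      by (elim wp_mono) auto
  qed (use z Kz in \<open>auto simp: Inv_def loaded_def\<close>)
  have "wp read_input (K + (K + (K + (K + 8 * (z * (100 * (K * z))) + 1) + 1) + 1) + 1) ?Q
    (\<lambda>_. 0) (a # n # length rows # rest 0)"
    unfolding read_input_def
    by (intro wp_Seq wp_Read wp_Store loop) (simp_all add: unit_cost_def loaded_def)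
  then have "wp read_input (2000 * (K * z ^ 2)) ?Q (\<lambda>_. 0) (a # n # length rows # rest 0)"
  proof (rule wp_mono)
    have "K * 1 \<le> K * z ^ 2" using z by (intro mult_left_mono) auto
    moreover have "8 * (z * (100 * (K * z))) = 800 * (K * z ^ 2)" by (simp add: power2_eq_square)
    ultimately show "K + (K + (K + (K + 8 * (z * (100 * (K * z))) + 1) + 1) + 1) + 1 \<le> 2000 * (K * z ^ 2)"
      using K1 by linarith
  qed
  then show ?thesis by (simp add: rest_def)
qed

section \<open>The whole algorithm and its time bound\<close>

lemma wp_solver:
  fixes a n z :: nat
  defines "k \<equiv> a - n"
  assumes rows: "\<And>r. r \<in> set rows \<Longrightarrow> length r \<le> 2 * z"
    and lits: "\<And>r l. r \<in> set rows \<Longrightarrow> l \<in> set r \<Longrightarrow> l < 2 * n"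
    and z: "length rows \<le> z" "n \<le> z" "1 \<le> z"
  shows "wp solver (65000 * (4 ^ k * (K * z ^ 3)))
    (\<lambda>s w. s 0 = (if k \<le> excess (hits rows) n {..<length rows} then 1 else 0))
    (\<lambda>_. 0) ([a, n, length rows] @ concat (map (\<lambda>r. length r # r) rows))"
    (is "wp _ _ ?Q _ ?w")
proof -
  interpret incidence "hits rows" n "length rows" z k
    using z by unfold_locales (auto simp: hits_def)
  have "wp solver (2000 * (K * z ^ 2) + 62000 * (4 ^ k * (K * z ^ 3)) + 1) ?Q (\<lambda>_. 0) ?w"
    unfolding solver_def
  proof (rule wp_Seq, rule wp_mono[OF wp_read_input[OF rows z(1,3)] le_refl])
    fix s w assume ld: "loaded (a - n) n (length rows) (entries n rows (length rows)) s"
    show "wp (Seq greedy decide) (62000 * (4 ^ k * (K * z ^ 3))) ?Q s w"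
    proof (rule wp_greedy_decide)
      show "core (\<lambda>_. 0) 0 (s(12 := 1))"
        unfolding core_def using ld entries_iff[of rows n, OF lits] bit_weights_zero
        by (simp add: loaded_def k_def)
    qed (use ld in \<open>auto simp: loaded_def\<close>)
  qed
  then show ?thesis
  proof (rule wp_mono)
    have "1 * (K * z ^ 2) \<le> 4 ^ k * (K * z ^ 3)" "1 * (1 * 1) \<le> 4 ^ k * (K * z ^ 3)"
      using z(3) Kz(3) by (intro mult_mono power_increasing; simp)+
    then show "2000 * (K * z ^ 2) + 62000 * (4 ^ k * (K * z ^ 3)) + 1 \<le> 65000 * (4 ^ k * (K * z ^ 3))"
      by linarith
  qed
qed


text \<open>The literals of a listed clause are distinct, so their codes are distinct numbers below
  \<open>2 * n\<close>.\<close>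

lemma encode_bounds:
  fixes F :: "'v cnf" and num :: "'v \<Rightarrow> nat"
  assumes cnf: "is_cnf F" and num: "bij_betw num (vars F) {..<n}"
    and cs: "\<forall>c\<in>set cs. distinct c" "mset (map set cs) = F"
    and r: "r \<in> set (map (map (lit_code num)) cs)"
  shows "length r \<le> 2 * n" and "l \<in> set r \<Longrightarrow> l < 2 * n"
proof -
  obtain c where c: "c \<in> set cs" "r = map (lit_code num) c" using r by auto
  have "set c \<in># F" using c(1) cs(2) by (metis image_eqI list.set_map set_mset_mset)
  then have vars: "var x \<in> vars F" if "x \<in> set c" for x
    using that by (auto simp: vars_def clause_vars_def)
  have less: "lit_code num x < 2 * n" if "x \<in> set c" for x
  proof -
    have "num (var x) < n" using bij_betwE[OF num] vars[OF that] by blast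
    then show ?thesis by (cases x) auto
  qed
  then show "l \<in> set r \<Longrightarrow> l < 2 * n" using c(2) by auto
  have "inj_on (lit_code num) (set c)"
  proof (rule inj_onI)
    fix x y assume xy: "x \<in> set c" "y \<in> set c" "lit_code num x = lit_code num y"
    have inj: "inj_on num (vars F)" using num by (rule bij_betw_imp_inj_on)
    have eq: "num (var x) = num (var y) \<longleftrightarrow> var x = var y"
      using vars xy by (intro inj_on_eq_iff[OF inj]) auto
    have "2 * i \<noteq> Suc (2 * j)" "Suc (2 * j) \<noteq> 2 * i" for i j :: nat by presburger+
    with eq xy(3) show "x = y" by (cases x; cases y) auto
  qed
  moreover have "distinct c" using cs(1) c(1) by blast
  ultimately have "distinct r" using c(2) by (simp add: distinct_map)
  then have "length r = card (set r)" by (simp add: distinct_card)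
  also have "\<dots> \<le> card {..<2 * n}" using less c(2) by (intro card_mono) auto
  finally show "length r \<le> 2 * n" by simp
qed

theorem theorem4:
  shows "\<exists>(P::com) (g::nat \<Rightarrow> real) (C::real) (d::nat).
    g \<in> O(\<lambda>k. (log 2 (real k))\<^sup>2) \<and>
    (\<forall>(F::nat cnf) (\<alpha>::nat) (w::nat list).
       transformed_special_instance F \<alpha> \<longrightarrow> encodes w F \<alpha> \<longrightarrow>
       (let k = nat (parameter F \<alpha>); n = card (vars F); m = size F in
          outputs_within P w (sat F \<ge> \<alpha>)
            (C * (2 * exp 1) powr (2 * real k + g k) * real (max 1 (m + n)) ^ d)))"
proof -
  let ?c = "65000 * K"
  let ?C = "real (?c * (6 + ?c))"
  have "outputs_within solver w (sat F \<ge> \<alpha>)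
      (?C * (2 * exp 1) powr (2 * real (nat (parameter F \<alpha>)) + 0) * real (max 1 (size F + card (vars F))) ^ 6)"
    if F: "transformed_special_instance F \<alpha>" and w: "encodes w F \<alpha>" for F :: "nat cnf" and \<alpha> w
  proof -
    define n where "n = card (vars F)"
    define z where "z = max 1 (size F + n)"
    define k where "k = \<alpha> - n"
    obtain num cs where num: "bij_betw num (vars F) {..<n}" and cs: "\<forall>c\<in>set cs. distinct c"
      "mset (map set cs) = F" and w: "w = encode num n cs \<alpha>"
      using w unfolding encodes_def n_def by blast
    define rows where "rows = map (map (lit_code num)) cs"
    have cnf: "is_cnf F" using F by (simp add: transformed_special_instance_def)
    have m: "length rows = size F" unfolding rows_def using cs(2) by (metis length_map size_mset)
    have z: "length rows \<le> z" "n \<le> z" "1 \<le> z" unfolding m z_def by auto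
    have w: "w = [\<alpha>, n, length rows] @ concat (map (\<lambda>r. length r # r) rows)"
      by (simp add: w encode_def rows_def comp_def)
    have lits: "l < 2 * n" if "r \<in> set rows" "l \<in> set r" for r l
      using encode_bounds(2)[OF cnf num cs] that unfolding rows_def by blast
    have len: "length r \<le> 2 * n" if "r \<in> set rows" for r
      using encode_bounds(1)[OF cnf num cs] that unfolding rows_def by blast
    have len_z: "length r \<le> 2 * z" if "r \<in> set rows" for r
      using len[OF that] z(2) by linarith
    let ?N = "65000 * (4 ^ k * (K * z ^ 3))"
    \<comment> \<open>Every input number is less than \<open>?L\<close>, hence less than
      \<open>2 ^ ?L\<close>.\<close>
    let ?L = "\<alpha> + 2 * n + length rows + 1"
    obtain t s' w' where ex: "exec solver (\<lambda>_. 0, w) t (s', w')"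
      and out: "s' 0 = (if k \<le> excess (hits rows) n {..<length rows} then 1 else 0)"
      and t: "\<And>L. fits L (\<lambda>_. 0) w \<Longrightarrow> t \<le> ?N * (L + ?N)"
    proof -
      have "wp solver ?N (\<lambda>s w. s 0 = (if k \<le> excess (hits rows) n {..<length rows} then 1 else 0)) (\<lambda>_. 0) w"
        unfolding k_def w by (rule wp_solver) (use len_z lits z in auto)
      then show thesis unfolding wp_def using that by blast
    qed
    have "fits ?L (\<lambda>_. 0) w"
    proof -
      have "x \<le> \<alpha> + 2 * n + length rows" if "x \<in> set w" for x
        using that len lits unfolding w by fastforce
      moreover have "x < 2 ^ ?L" if "x \<le> \<alpha> + 2 * n + length rows" for x
      proof -
        have "x < ?L" using that by simp
        also have "?L < 2 ^ ?L" by (rule less_exp)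
        finally show ?thesis .
      qed
      ultimately show ?thesis unfolding fits_def by simp
    qed
    then have "t \<le> ?N * (?L + ?N)" by (rule t)
    \<comment> \<open>Both factors are multiples of \<open>4 ^ k * z ^ 3\<close>: \<open>?N\<close>
      with constant \<open>?c\<close>, and \<open>?L\<close> with constant 6, because
      \<open>\<alpha> \<le> k + n\<close> gives \<open>?L \<le> k + 5 * z\<close>. Their product
      explains \<open>16 ^ k\<close>, the degree 6 and the constant \<open>?C\<close>.\<close>
    also have "\<dots> \<le> (?c * (4 ^ k * z ^ 3)) * ((6 + ?c) * (4 ^ k * z ^ 3))"
    proof (rule mult_mono)
      have "k < 4 ^ k" by (rule less_exp[THEN less_le_trans]) (simp add: power_mono)
      moreover have "1 * z ^ 1 \<le> 4 ^ k * z ^ 3" using z(3) by (intro mult_mono power_increasing) auto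
      then have "z \<le> 4 ^ k * z ^ 3" by simp
      moreover have "4 ^ k * 1 \<le> 4 ^ k * z ^ 3" using z(3) by (intro mult_left_mono) auto
      then have "4 ^ k \<le> 4 ^ k * z ^ 3" by (simp only: mult_1_right)
      moreover have "?L \<le> k + 5 * z" using z unfolding k_def by linarith
      ultimately have "?L \<le> 6 * (4 ^ k * z ^ 3)" by linarith
      then show "?L + ?N \<le> (6 + ?c) * (4 ^ k * z ^ 3)" by (simp add: algebra_simps)
    qed (simp_all add: algebra_simps)
    also have "\<dots> = (?c * (6 + ?c)) * (16 ^ k * z ^ 6)"
    proof -
      have "(4 ^ k * z ^ 3) * (4 ^ k * z ^ 3) = (4 * 4) ^ k * z ^ (3 + 3)"
        by (simp only: power_mult_distrib power_add mult_ac)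
      then show ?thesis by (simp add: mult_ac)
    qed
    finally have "real t \<le> real ((?c * (6 + ?c)) * (16 ^ k * z ^ 6))" by (simp only: of_nat_le_iff)
    also have "\<dots> = ?C * 16 ^ k * real z ^ 6" by simp
    also have "\<dots> \<le> ?C * (2 * exp 1) powr (2 * real (nat (parameter F \<alpha>)) + 0) * real z ^ 6"
    proof (intro mult_right_mono mult_left_mono)
      have kp: "k \<le> nat (parameter F \<alpha>)"
        using matching_number_le_vars[OF cnf] unfolding k_def n_def parameter_def by linarith
      have "(2 :: real) \<le> exp 1" using exp_ge_add_one_self[of 1] by simp
      then have e: "4 \<le> (2 * exp 1 :: real)" by simp
      have "(16 :: real) ^ k = 4 powr (2 * real k)"
        by (simp add: powr_realpow[symmetric] powr_powr[symmetric] powr_numeral)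
      also have "\<dots> \<le> (2 * exp 1) powr (2 * real k)" using e by (intro powr_mono2) auto
      also have "\<dots> \<le> (2 * exp 1) powr (2 * real (nat (parameter F \<alpha>)) + 0)"
        using kp e by (intro powr_mono) auto
      finally show "(16 :: real) ^ k \<le> (2 * exp 1) powr (2 * real (nat (parameter F \<alpha>)) + 0)" .
    qed auto
    finally have "real t \<le> ?C * (2 * exp 1) powr (2 * real (nat (parameter F \<alpha>)) + 0) * real z ^ 6" .
    moreover have "sat F \<ge> \<alpha> \<longleftrightarrow> k \<le> excess (hits rows) n {..<length rows}"
      using special_sat_iff[OF F num cs(2)] unfolding k_def rows_def by simp
    then have "s' 0 = (if sat F \<ge> \<alpha> then 1 else 0)" using out by simp
    ultimately show ?thesis
      unfolding outputs_within_def initial_state_def z_def n_def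
      using ex by (intro exI[of _ t] exI[of _ "(s', w')"]) auto
  qed
  then show ?thesis
    unfolding Let_def by (intro exI[of _ solver] exI[of _ "\<lambda>_. 0"] exI[of _ ?C] exI[of _ 6]) auto
qed

end
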